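(* Let $\mathcal{T}$ be a triangulated category with a fixed $t$-structure $\mathcal{U}$, and write $\mathcal{T}^b=\mathcal{U}_{\mathbb{N}}$. Assume that $\mathcal{U}$ is regular. Then the bijection $\mathcal{V}\mapsto\mathcal{V}^b$ from the set of $t$-structures $\mathcal{V}$ on $\mathcal{T}$ with $d(\mathcal{U},\mathcal{V})<+\infty$ to the set of $t$-structures $\mathcal{V}'$ on $\mathcal{T}^b$ with $d(\mathcal{U}^b,\mathcal{V}')<+\infty$ restricts to a bijection $$\{\text{hereditary } t\text{-structures } \mathcal{V} \text{ on } \mathcal{T} \text{ with } d(\mathcal{U},\mathcal{V})<+\infty\}\longrightarrow \{\text{hereditary } t\text{-structures } \mathcal{V}' \text{ on } \mathcal{T}^b \text{ with } d(\mathcal{U}^b,\mathcal{V}')<+\infty\}.$$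
   Context: Let $\Sigma$ denote the translation functor of a triangulated category. A $t$-structure $\mathcal{U}=(\mathcal{U}_{\leq 0},\mathcal{U}_{\geq 0})$ on a triangulated category $\mathcal{T}$ consists of two full subcategories (closed under isomorphisms) such that: (T1) $\Sigma\mathcal{U}_{\leq 0}\subseteq\mathcal{U}_{\leq 0}$ and $\Sigma^{-1}\mathcal{U}_{\geq 0}\subseteq\mathcal{U}_{\geq 0}$; (T2) $\mathrm{Hom}_{\mathcal{T}}(X,Y)=0$ for all $X\in\mathcal{U}_{\leq 0}$, $Y\in\Sigma^{-1}\mathcal{U}_{\geq 0}$; (T3) every $Z\in\mathcal{T}$ fits into an exact triangle $X\to Z\to \Sigma^{-1}(Y)\to\Sigma(X)$ with $X\in\mathcal{U}_{\leq 0}$, $Y\in\mathcal{U}_{\geq 0}$. For $n\in\mathbb{Z}$ put $\mathcal{U}_{\leq n}=\Sigma^{-n}\mathcal{U}_{\leq 0}$ and $\mathcal{U}_{\geq n}=\Sigma^{-n}\mathcal{U}_{\geq 0}$. For $m\leq n$ put $\mathcal{U}_{[m,n]}=\mathcal{U}_{\geq m}\cap\mathcal{U}_{\leq n}$, and put $\mathcal{U}_{\mathbb{N}}=\bigcup_{n\geq 0}\mathcal{U}_{[-n,n]}$; it is the smallest triangulated full subcategory of $\mathcal{T}$ containing the heart $\mathcal{U}_0=\mathcal{U}_{\leq 0}\cap\mathcal{U}_{\geq 0}$. The $t$-structure $\mathcal{U}$ restricts to the $t$-structure $\mathcal{U}^b=(\mathcal{U}_{\mathbb{N}}\cap\mathcal{U}_{\leq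 0},\ \mathcal{U}_{\mathbb{N}}\cap\mathcal{U}_{\geq 0})$ on $\mathcal{U}_{\mathbb{N}}$. The same notation is used for any other $t$-structure $\mathcal{V}$; when $d(\mathcal{U},\mathcal{V})<+\infty$ one has $\mathcal{V}_{\mathbb{N}}=\mathcal{U}_{\mathbb{N}}=\mathcal{T}^b$, so $\mathcal{V}^b$ is a $t$-structure on $\mathcal{T}^b$. The distance $d(\mathcal{U},\mathcal{V})$ of two $t$-structures on the same triangulated category is the smallest natural number $d\geq 0$ such that $\mathcal{V}_{\leq m}\subseteq\mathcal{U}_{\leq 0}\subseteq\mathcal{V}_{\leq m+d}$ for some integer $m$; if no such $d$ exists, $d(\mathcal{U},\mathcal{V})=+\infty$. Known fact fixing the setting: $\mathcal{V}\mapsto\mathcal{V}^b$ is a bijection from the $t$-structures $\mathcal{V}$ on $\mathcal{T}$ with $d(\mathcal{U},\mathcal{V})<+\infty$ to the $t$-structures $\mathcal{V}'$ on $\mathcal{T}^b$ with $d(\mathcal{U}^b,\mathcal{V}')<+\infty$. A $t$-structure $\mathcal{U}$ on $\mathcal{T}$ is hereditary if $\mathrm{Hom}_{\mathcal{T}}(X,Y)=0$ for all $X\in\mathcal{U}_{\geq 0}$ and $Y\in\mathcal{U}_{\leq -2}$. Let $\tau_{\leq n}$ be the right adjoint of the inclusion $\mathcal{U}_{\leq n}\hookrightarrow\mathcal{T}$ and $\tau_{\geq n}$ the left adjoint of the inclusion $\mathcal{U}_{\geq n}\hookrightarrow\mathcal{T}$ (truncation functors). The $t$-structure $\mathcal{U}$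 is regular if the canonical map $\mathrm{Hom}_{\mathcal{T}}(X,Y)\to\varprojlim_{n\to+\infty}\mathrm{Hom}_{\mathcal{T}}(\tau_{\leq n}(X),Y)$ is injective for every $X\in\mathcal{T}$ and every $Y\in\bigcup_{m\in\mathbb{Z}}\mathcal{U}_{\leq m}$, and the canonical map $\mathrm{Hom}_{\mathcal{T}}(X,Y)\to\varprojlim_{n\to+\infty}\mathrm{Hom}_{\mathcal{T}}(X,\tau_{\geq -n}(Y))$ is injective for every $Y\in\mathcal{T}$ and every $X\in\bigcup_{m\in\mathbb{Z}}\mathcal{U}_{\geq m}$. *)

theory Defs
  imports "HOL-Algebra.Group" "HOL-Library.Extended_Nat"
begin

section \<open>Triangulated categories\<close>

text \<open>
  Objects and arrows live in arbitrary types and are cut out by the carriers \<open>obj\<close> and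
  \<open>arr\<close>; nothing is assumed about values of the operations outside the carriers.
  \<open>sig_obj\<close> and \<open>sig_arr\<close> are the translation functor, \<open>tri\<close> is the class of exact triangles;
  a triangle \<open>X \<rightarrow> Y \<rightarrow> Z \<rightarrow> \<Sigma> X\<close> is given by its three arrows.
\<close>

record ('o, 'a) tricat =
  obj :: "'o set"
  arr :: "'a set"
  src :: "'a \<Rightarrow> 'o"
  tgt :: "'a \<Rightarrow> 'o"
  idt :: "'o \<Rightarrow> 'a"
  cmp :: "'a \<Rightarrow> 'a \<Rightarrow> 'a"  (infixl "\<cdot>\<index>" 70)
  plus_arr :: "'a \<Rightarrow> 'a \<Rightarrow> 'a"
  zero_arr :: "'o \<Rightarrow> 'o \<Rightarrow> 'a"
  sig_obj :: "'o \<Rightarrow> 'o"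
  sig_arr :: "'a \<Rightarrow> 'a"
  tri :: "('a \<times> 'a \<times> 'a) set"

definition homs :: "('o, 'a, 'z) tricat_scheme \<Rightarrow> 'o \<Rightarrow> 'o \<Rightarrow> 'a set" where
  "homs C X Y = {f \<in> arr C. src C f = X \<and> tgt C f = Y}"

locale category =
  fixes C :: "('o, 'a, 'z) tricat_scheme" (structure)
  assumes src_obj: "f \<in> arr C \<Longrightarrow> src C f \<in> obj C"
    and tgt_obj: "f \<in> arr C \<Longrightarrow> tgt C f \<in> obj C"
    and idt_homs: "X \<in> obj C \<Longrightarrow> idt C X \<in> homs C X X"
    and cmp_homs: "\<lbrakk>f \<in> homs C X Y; g \<in> homs C Y Z\<rbrakk> \<Longrightarrow> g \<cdot> f \<in> homs C X Z"
    and cmp_idt: "f \<in> homs C X Y \<Longrightarrow> f \<cdot> idt C X = f"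
    and idt_cmp: "f \<in> homs C X Y \<Longrightarrow> idt C Y \<cdot> f = f"
    and cmp_assoc: "\<lbrakk>f \<in> homs C W X; g \<in> homs C X Y; h \<in> homs C Y Z\<rbrakk>
                      \<Longrightarrow> h \<cdot> (g \<cdot> f) = (h \<cdot> g) \<cdot> f"

definition iso_arr :: "('o, 'a, 'z) tricat_scheme \<Rightarrow> 'a \<Rightarrow> bool" where
  "iso_arr C f \<longleftrightarrow> f \<in> arr C \<and>
     (\<exists>g \<in> homs C (tgt C f) (src C f).
        g \<cdot>\<^bsub>C\<^esub> f = idt C (src C f) \<and> f \<cdot>\<^bsub>C\<^esub> g = idt C (tgt C f))"

definition isomorphic :: "('o, 'a, 'z) tricat_scheme \<Rightarrow> 'o \<Rightarrow> 'o \<Rightarrow> bool" where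
  "isomorphic C X Y \<longleftrightarrow> (\<exists>f \<in> homs C X Y. iso_arr C f)"

definition hom_group :: "('o, 'a, 'z) tricat_scheme \<Rightarrow> 'o \<Rightarrow> 'o \<Rightarrow> 'a monoid" where
  "hom_group C X Y = \<lparr>carrier = homs C X Y, mult = plus_arr C, one = zero_arr C X Y\<rparr>"

definition neg_arr :: "('o, 'a, 'z) tricat_scheme \<Rightarrow> 'a \<Rightarrow> 'a" where
  "neg_arr C f = inv\<^bsub>hom_group C (src C f) (tgt C f)\<^esub> f"

definition zero_object :: "('o, 'a, 'z) tricat_scheme \<Rightarrow> 'o \<Rightarrow> bool" where
  "zero_object C Z \<longleftrightarrow> Z \<in> obj C \<and>
     (\<forall>X \<in> obj C. (\<exists>!f. f \<in> homs C X Z) \<and> (\<exists>!f. f \<in> homs C Z X))"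

locale additive_category = category +
  assumes hom_comm_group: "\<lbrakk>X \<in> obj C; Y \<in> obj C\<rbrakk> \<Longrightarrow> comm_group (hom_group C X Y)"
    and cmp_plus_right: "\<lbrakk>f \<in> homs C X Y; f' \<in> homs C X Y; g \<in> homs C Y Z\<rbrakk>
                           \<Longrightarrow> g \<cdot> plus_arr C f f' = plus_arr C (g \<cdot> f) (g \<cdot> f')"
    and cmp_plus_left: "\<lbrakk>f \<in> homs C X Y; g \<in> homs C Y Z; g' \<in> homs C Y Z\<rbrakk>
                          \<Longrightarrow> plus_arr C g g' \<cdot> f = plus_arr C (g \<cdot> f) (g' \<cdot> f)"
    and ex_zero_object: "\<exists>Z. zero_object C Z"
    and ex_biproduct: "\<lbrakk>X \<in> obj C; Y \<in> obj C\<rbrakk> \<Longrightarrow>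
          \<exists>B \<in> obj C. \<exists>i \<in> homs C X B. \<exists>j \<in> homs C Y B. \<exists>p \<in> homs C B X. \<exists>q \<in> homs C B Y.
            p \<cdot> i = idt C X \<and> q \<cdot> j = idt C Y \<and>
            p \<cdot> j = zero_arr C Y X \<and> q \<cdot> i = zero_arr C X Y \<and>
            plus_arr C (i \<cdot> p) (j \<cdot> q) = idt C B"

text \<open>
  The translation functor is an additive autoequivalence, that is, fully faithful and
  essentially surjective. An automorphism of the category is the special case in which
  \<open>sig_obj\<close> is bijective on objects.
\<close>

locale translation_category = additive_category +
  assumes sig_obj_obj: "X \<in> obj C \<Longrightarrow> sig_obj C X \<in> obj C"
    and sig_idt: "X \<in> obj C \<Longrightarrow> sig_arr C (idt C X) = idt C (sig_obj C X)"
    and sig_cmp: "\<lbrakk>f \<in> homs C X Y; g \<in> homs C Y Z\<rbrakk>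
                    \<Longrightarrow> sig_arr C (g \<cdot> f) = sig_arr C g \<cdot> sig_arr C f"
    and sig_plus: "\<lbrakk>f \<in> homs C X Y; f' \<in> homs C X Y\<rbrakk>
                     \<Longrightarrow> sig_arr C (plus_arr C f f') = plus_arr C (sig_arr C f) (sig_arr C f')"
    and sig_fully_faithful: "\<lbrakk>X \<in> obj C; Y \<in> obj C\<rbrakk>
          \<Longrightarrow> bij_betw (sig_arr C) (homs C X Y) (homs C (sig_obj C X) (sig_obj C Y))"
    and sig_ess_surj: "Y \<in> obj C \<Longrightarrow> \<exists>X \<in> obj C. isomorphic C (sig_obj C X) Y"

definition triangle :: "('o, 'a, 'z) tricat_scheme \<Rightarrow> 'a \<Rightarrow> 'a \<Rightarrow> 'a \<Rightarrow> bool" where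
  "triangle C f g h \<longleftrightarrow> f \<in> arr C \<and> g \<in> homs C (tgt C f) (src C h) \<and>
     h \<in> homs C (tgt C g) (sig_obj C (src C f))"

definition triangle_morphism ::
  "('o, 'a, 'z) tricat_scheme \<Rightarrow> 'a \<times> 'a \<times> 'a \<Rightarrow> 'a \<times> 'a \<times> 'a \<Rightarrow> 'a \<Rightarrow> 'a \<Rightarrow> 'a \<Rightarrow> bool" where
  "triangle_morphism C = (\<lambda>(f, g, h) (f', g', h') a b c.
     a \<in> homs C (src C f) (src C f') \<and> b \<in> homs C (src C g) (src C g') \<and>
     c \<in> homs C (src C h) (src C h') \<and>
     b \<cdot>\<^bsub>C\<^esub> f = f' \<cdot>\<^bsub>C\<^esub> a \<and> c \<cdot>\<^bsub>C\<^esub> g = g' \<cdot>\<^bsub>C\<^esub> b \<and> sig_arr C a \<cdot>\<^bsub>C\<^esub> h = h' \<cdot>\<^bsub>C\<^esub> c)"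

text \<open>
  Verdier's axioms; \<open>TR1a\<close>, \<open>TR1b\<close>, \<open>TR1c\<close> are the three parts of (TR1), and \<open>TR4\<close> is the
  octahedral axiom for \<open>X \<rightarrow> Y \<rightarrow> Z\<close>, the arrows \<open>f\<close>, \<open>g\<close> and \<open>g \<cdot> f\<close> having the cones
  \<open>tgt f'\<close>, \<open>tgt g'\<close> and \<open>tgt h'\<close>.
\<close>

locale triangulated_category = translation_category +
  assumes tri_triangle: "(f, g, h) \<in> tri C \<Longrightarrow> triangle C f g h"
    and TR1a: "\<lbrakk>(f, g, h) \<in> tri C; triangle C f' g' h';
                triangle_morphism C (f, g, h) (f', g', h') a b c;
                iso_arr C a; iso_arr C b; iso_arr C c\<rbrakk> \<Longrightarrow> (f', g', h') \<in> tri C"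
    and TR1b: "\<lbrakk>X \<in> obj C; zero_object C Z\<rbrakk>
                \<Longrightarrow> (idt C X, zero_arr C X Z, zero_arr C Z (sig_obj C X)) \<in> tri C"
    and TR1c: "f \<in> arr C \<Longrightarrow> \<exists>g h. (f, g, h) \<in> tri C"
    and TR2: "triangle C f g h \<Longrightarrow>
                (f, g, h) \<in> tri C \<longleftrightarrow> (g, h, neg_arr C (sig_arr C f)) \<in> tri C"
    and TR3: "\<lbrakk>(f, g, h) \<in> tri C; (f', g', h') \<in> tri C;
               a \<in> homs C (src C f) (src C f'); b \<in> homs C (tgt C f) (tgt C f');
               b \<cdot> f = f' \<cdot> a\<rbrakk> \<Longrightarrow> \<exists>c. triangle_morphism C (f, g, h) (f', g', h') a b c"
    and TR4: "\<lbrakk>f \<in> homs C X Y; g \<in> homs C Y Z;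
               (f, f', f'') \<in> tri C; (g, g', g'') \<in> tri C; (g \<cdot> f, h', h'') \<in> tri C\<rbrakk> \<Longrightarrow>
               \<exists>u \<in> homs C (tgt C f') (tgt C h'). \<exists>v \<in> homs C (tgt C h') (tgt C g').
                 (u, v, sig_arr C f' \<cdot> g'') \<in> tri C \<and>
                 u \<cdot> f' = h' \<cdot> g \<and> h'' \<cdot> u = f'' \<and> v \<cdot> h' = g' \<and> g'' \<cdot> v = sig_arr C f \<cdot> h''"

text \<open>The full subcategory on the objects in \<open>S\<close>, with the translation functor and the exact
  triangles inherited from \<open>C\<close>.\<close>

definition full_subcat :: "('o, 'a) tricat \<Rightarrow> 'o set \<Rightarrow> ('o, 'a) tricat" where
  "full_subcat C S =
     (let A = {f \<in> arr C. src C f \<in> S \<and> tgt C f \<in> S}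
      in C\<lparr>obj := obj C \<inter> S, arr := A, tri := tri C \<inter> A \<times> A \<times> A\<rparr>)"

section \<open>t-structures\<close>

text \<open>
  A full subcategory closed under isomorphisms is given by its set of objects, and a t-structure
  \<open>U\<close> by the pair \<open>(U\<^sub>\<le>\<^sub>0, U\<^sub>\<ge>\<^sub>0)\<close>. For such a subcategory \<open>S\<close> and \<open>n < 0\<close>, the objects of
  \<open>\<Sigma>\<^sup>n S\<close> are those which \<open>\<Sigma>\<close> applied \<open>- n\<close> times takes into \<open>S\<close>, so no quasi-inverse of \<open>\<Sigma>\<close>
  has to be chosen.
\<close>

type_synonym 'o tpair = "'o set \<times> 'o set"

definition iso_closed :: "('o, 'a, 'z) tricat_scheme \<Rightarrow> 'o set \<Rightarrow> bool" where
  "iso_closed C S \<longleftrightarrow> S \<subseteq> obj C \<and> (\<forall>X \<in> S. \<forall>Y \<in> obj C. isomorphic C X Y \<longrightarrow> Y \<in> S)"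

definition shift :: "('o, 'a, 'z) tricat_scheme \<Rightarrow> int \<Rightarrow> 'o set \<Rightarrow> 'o set" where
  "shift C n S =
     (if n \<ge> 0 then {X \<in> obj C. \<exists>Y \<in> S. isomorphic C ((sig_obj C ^^ nat n) Y) X}
      else {X \<in> obj C. (sig_obj C ^^ nat (- n)) X \<in> S})"

definition t_structure :: "('o, 'a, 'z) tricat_scheme \<Rightarrow> 'o tpair \<Rightarrow> bool" where
  "t_structure C U \<longleftrightarrow>
     iso_closed C (fst U) \<and> iso_closed C (snd U) \<and>
     shift C 1 (fst U) \<subseteq> fst U \<and> shift C (- 1) (snd U) \<subseteq> snd U \<and>
     (\<forall>X \<in> fst U. \<forall>Y \<in> shift C (- 1) (snd U). homs C X Y = {zero_arr C X Y}) \<and>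
     (\<forall>Z \<in> obj C. \<exists>f g h. (f, g, h) \<in> tri C \<and>
        src C f \<in> fst U \<and> tgt C f = Z \<and> tgt C g \<in> shift C (- 1) (snd U))"

definition t_le :: "('o, 'a, 'z) tricat_scheme \<Rightarrow> 'o tpair \<Rightarrow> int \<Rightarrow> 'o set" where
  "t_le C U n = shift C (- n) (fst U)"

definition t_ge :: "('o, 'a, 'z) tricat_scheme \<Rightarrow> 'o tpair \<Rightarrow> int \<Rightarrow> 'o set" where
  "t_ge C U n = shift C (- n) (snd U)"

definition t_interval :: "('o, 'a, 'z) tricat_scheme \<Rightarrow> 'o tpair \<Rightarrow> int \<Rightarrow> int \<Rightarrow> 'o set" where
  "t_interval C U m n = t_ge C U m \<inter> t_le C U n"

definition t_bounded :: "('o, 'a, 'z) tricat_scheme \<Rightarrow> 'o tpair \<Rightarrow> 'o set" where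
  "t_bounded C U = (\<Union>n::nat. t_interval C U (- int n) (int n))"

definition t_restrict :: "('o, 'a, 'z) tricat_scheme \<Rightarrow> 'o tpair \<Rightarrow> 'o tpair" where
  "t_restrict C V = (t_bounded C V \<inter> fst V, t_bounded C V \<inter> snd V)"

text \<open>The infimum of the empty set in \<^typ>\<open>enat\<close> is \<open>\<infinity>\<close>.\<close>

definition t_dist :: "('o, 'a, 'z) tricat_scheme \<Rightarrow> 'o tpair \<Rightarrow> 'o tpair \<Rightarrow> enat" where
  "t_dist C U V =
     Inf {enat d | d. \<exists>m::int. t_le C V m \<subseteq> fst U \<and> fst U \<subseteq> t_le C V (m + int d)}"

definition hereditary :: "('o, 'a, 'z) tricat_scheme \<Rightarrow> 'o tpair \<Rightarrow> bool" where
  "hereditary C U \<longleftrightarrow>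
     (\<forall>X \<in> t_ge C U 0. \<forall>Y \<in> t_le C U (- 2). homs C X Y = {zero_arr C X Y})"

section \<open>Truncation and regularity\<close>

text \<open>
  A right (left) adjoint of the inclusion of a full subcategory amounts to the choice of a
  couniversal (universal) arrow for every object, the counit (unit) at that object.
  \<open>tau_le C U n X\<close> is the counit \<open>\<tau>\<^sub>\<le>\<^sub>n X \<rightarrow> X\<close> and \<open>tau_ge C U n X\<close> the unit \<open>X \<rightarrow> \<tau>\<^sub>\<ge>\<^sub>n X\<close>, so
  that the truncated objects are the source of the former and the target of the latter.
\<close>

definition coreflection :: "('o, 'a, 'z) tricat_scheme \<Rightarrow> 'o set \<Rightarrow> 'o \<Rightarrow> 'a \<Rightarrow> bool" where
  "coreflection C S X e \<longleftrightarrow> e \<in> homs C (src C e) X \<and> src C e \<in> S \<and>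
     (\<forall>W \<in> S. \<forall>f \<in> homs C W X. \<exists>!g. g \<in> homs C W (src C e) \<and> e \<cdot>\<^bsub>C\<^esub> g = f)"

definition reflection :: "('o, 'a, 'z) tricat_scheme \<Rightarrow> 'o set \<Rightarrow> 'o \<Rightarrow> 'a \<Rightarrow> bool" where
  "reflection C S X e \<longleftrightarrow> e \<in> homs C X (tgt C e) \<and> tgt C e \<in> S \<and>
     (\<forall>W \<in> S. \<forall>f \<in> homs C X W. \<exists>!g. g \<in> homs C (tgt C e) W \<and> g \<cdot>\<^bsub>C\<^esub> e = f)"

definition tau_le :: "('o, 'a, 'z) tricat_scheme \<Rightarrow> 'o tpair \<Rightarrow> int \<Rightarrow> 'o \<Rightarrow> 'a" where
  "tau_le C U n X = (SOME e. coreflection C (t_le C U n) X e)"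

definition tau_ge :: "('o, 'a, 'z) tricat_scheme \<Rightarrow> 'o tpair \<Rightarrow> int \<Rightarrow> 'o \<Rightarrow> 'a" where
  "tau_ge C U n X = (SOME e. reflection C (t_ge C U n) X e)"

text \<open>
  The limits of \<open>Hom (\<tau>\<^sub>\<le>\<^sub>n X, Y)\<close> and of \<open>Hom (X, \<tau>\<^sub>\<ge>\<^sub>-\<^sub>n Y)\<close> for \<open>n \<rightarrow> +\<infinity>\<close>, as sets of compatible
  families. The transition arrows \<open>\<tau>\<^sub>\<le>\<^sub>m X \<rightarrow> \<tau>\<^sub>\<le>\<^sub>n X\<close> and \<open>\<tau>\<^sub>\<ge>\<^sub>-\<^sub>n Y \<rightarrow> \<tau>\<^sub>\<ge>\<^sub>-\<^sub>m Y\<close> for \<open>m \<le> n\<close> are the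
  unique ones over \<open>X\<close> and under \<open>Y\<close>.
\<close>

definition lim_le ::
  "('o, 'a, 'z) tricat_scheme \<Rightarrow> 'o tpair \<Rightarrow> 'o \<Rightarrow> 'o \<Rightarrow> (int \<Rightarrow> 'a) set" where
  "lim_le C U X Y = {\<phi>. (\<forall>n. \<phi> n \<in> homs C (src C (tau_le C U n X)) Y) \<and>
     (\<forall>m n t. m \<le> n \<and> t \<in> homs C (src C (tau_le C U m X)) (src C (tau_le C U n X)) \<and>
        tau_le C U n X \<cdot>\<^bsub>C\<^esub> t = tau_le C U m X \<longrightarrow> \<phi> n \<cdot>\<^bsub>C\<^esub> t = \<phi> m)}"

definition lim_ge ::
  "('o, 'a, 'z) tricat_scheme \<Rightarrow> 'o tpair \<Rightarrow> 'o \<Rightarrow> 'o \<Rightarrow> (int \<Rightarrow> 'a) set" where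
  "lim_ge C U X Y = {\<phi>. (\<forall>n. \<phi> n \<in> homs C X (tgt C (tau_ge C U (- n) Y))) \<and>
     (\<forall>m n t. m \<le> n \<and> t \<in> homs C (tgt C (tau_ge C U (- n) Y)) (tgt C (tau_ge C U (- m) Y)) \<and>
        t \<cdot>\<^bsub>C\<^esub> tau_ge C U (- n) Y = tau_ge C U (- m) Y \<longrightarrow> t \<cdot>\<^bsub>C\<^esub> \<phi> n = \<phi> m)}"

definition injective_map :: "('x \<Rightarrow> 'y) \<Rightarrow> 'x set \<Rightarrow> 'y set \<Rightarrow> bool" where
  "injective_map \<phi> A B \<longleftrightarrow> \<phi> ` A \<subseteq> B \<and> inj_on \<phi> A"

definition regular :: "('o, 'a, 'z) tricat_scheme \<Rightarrow> 'o tpair \<Rightarrow> bool" where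
  "regular C U \<longleftrightarrow>
     (\<forall>X \<in> obj C. \<forall>Y \<in> (\<Union>m. t_le C U m).
        injective_map (\<lambda>f n. f \<cdot>\<^bsub>C\<^esub> tau_le C U n X) (homs C X Y) (lim_le C U X Y)) \<and>
     (\<forall>Y \<in> obj C. \<forall>X \<in> (\<Union>m. t_ge C U m).
        injective_map (\<lambda>f n. tau_ge C U (- n) Y \<cdot>\<^bsub>C\<^esub> f) (homs C X Y) (lim_ge C U X Y))"

section \<open>The two sets of t-structures\<close>

definition finite_dist_t_structures ::
  "('o, 'a, 'z) tricat_scheme \<Rightarrow> 'o tpair \<Rightarrow> 'o tpair set" where
  "finite_dist_t_structures C U = {V. t_structure C V \<and> t_dist C U V < \<infinity>}"

definition hereditary_finite_dist_t_structures ::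
  "('o, 'a, 'z) tricat_scheme \<Rightarrow> 'o tpair \<Rightarrow> 'o tpair set" where
  "hereditary_finite_dist_t_structures C U = {V \<in> finite_dist_t_structures C U. hereditary C V}"

end

theory Submission
  imports Defs
begin

text \<open>
  \<^bold>\<open>Reduction to torsion pairs.\<close> A t-structure is determined by the pair \<open>(A, B)\<close> of its parts
  \<open>V\<^sub>\<le>\<^sub>0\<close> and \<open>V\<^sub>\<ge>\<^sub>1\<close>. Such a pair is orthogonal, \<open>A\<close> is stable under \<open>\<Sigma>\<close>, and every object is an
  extension of an object of \<open>B\<close> by one of \<open>A\<close>; conversely these properties make \<open>A\<close> and \<open>B\<close> each
  other's orthogonal complement, so that \<open>A\<close> alone determines the t-structure
  (\<open>torsion_pair_left_iff\<close>, \<open>torsion_pair_right_iff\<close>). All of this is done for t-structures on a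
  triangulated subcategory with object set \<open>N\<close>, working with the triangles of the ambient category:
  \<open>N\<close> is either everything or the set of bounded objects, and \<open>t_structure_full_subcat_iff\<close>
  shows that these are the t-structures of the full subcategory on \<open>N\<close>. Finite distance between
  \<open>U\<close> and \<open>V\<close> means \<open>U\<^sub>\<le>\<^sub>a \<subseteq> V\<^sub>\<le>\<^sub>0 \<subseteq> U\<^sub>\<le>\<^sub>b\<close> for some \<open>a\<close>, \<open>b\<close>.

  \<^bold>\<open>The bijection.\<close> Let \<open>V\<close> be at finite distance from \<open>U\<close>. Truncating \<open>X \<in> V\<^sub>\<le>\<^sub>0\<close> with respect to
  \<open>U\<close> at \<open>a\<close> writes \<open>X\<close> as an extension of a bounded object of \<open>V\<^sub>\<le>\<^sub>0\<close> by an object of \<open>U\<^sub>\<le>\<^sub>a\<close>, so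
  \<open>V\<close> can be recovered from its bounded part (\<open>t_restrict_inj\<close>). This also says what the inverse must
  be: if \<open>(A', B')\<close> is the torsion pair of a t-structure on the bounded objects with
  \<open>U\<^sup>b\<^sub>\<le>\<^sub>a \<subseteq> A' \<subseteq> U\<^sup>b\<^sub>\<le>\<^sub>b\<close> and \<open>a \<le> b\<close>, take the extensions of \<open>A'\<close> by \<open>U\<^sub>\<le>\<^sub>a\<close> and the extensions of
  \<open>U\<^sub>>\<^sub>b\<close> by \<open>B'\<close>. Every object has a filtration with pieces in \<open>U\<^sub>\<le>\<^sub>a\<close>, \<open>U\<^sub>>\<^sub>a \<inter> U\<^sub>\<le>\<^sub>b\<close> and \<open>U\<^sub>>\<^sub>b\<close>; the
  middle piece is bounded and splits further into \<open>A'\<close> and \<open>B'\<close>, and associativity of extensions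
  (the octahedral axiom) groups the four pieces in pairs (\<open>t_restrict_surj\<close>).

  \<^bold>\<open>Heredity.\<close> Restriction to the bounded objects clearly preserves it. Conversely let
  \<open>X \<in> V\<^sub>\<ge>\<^sub>0\<close> and \<open>Y \<in> V\<^sub>\<le>\<^sub>-\<^sub>2\<close>. Regularity of \<open>U\<close> detects an arrow \<open>X \<rightarrow> Y\<close> first on the truncations
  \<open>\<tau>\<^sub>\<le>\<^sub>k X\<close>, and then in the truncations \<open>\<tau>\<^sub>\<ge>\<^sub>-\<^sub>k Y\<close>. For large \<open>k\<close> the pieces that are cut off lie far
  out, where \<open>U\<close> and \<open>V\<close> cannot be distinguished; so the truncations still lie in \<open>V\<^sub>\<ge>\<^sub>0\<close> and \<open>V\<^sub>\<le>\<^sub>-\<^sub>2\<close>.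
  They are bounded, and there are no arrows between them (\<open>hom_zero_hereditary_restrict_iff\<close>).
\<close>

section \<open>Arrows\<close>

lemma homsD: "f \<in> homs C X Y \<Longrightarrow> f \<in> arr C \<and> src C f = X \<and> tgt C f = Y"
  by (simp add: homs_def)

lemma (in category) homs_obj: "f \<in> homs C X Y \<Longrightarrow> X \<in> obj C \<and> Y \<in> obj C"
  using src_obj tgt_obj by (auto simp: homs_def)

lemma isomorphic_iff:
  "isomorphic C X Y \<longleftrightarrow> (\<exists>f \<in> homs C X Y. \<exists>g \<in> homs C Y X.
     g \<cdot>\<^bsub>C\<^esub> f = idt C X \<and> f \<cdot>\<^bsub>C\<^esub> g = idt C Y)"
  by (auto simp: isomorphic_def iso_arr_def homs_def)

lemma iso_arrI:
  assumes "f \<in> homs C X Y" "g \<in> homs C Y X" "g \<cdot>\<^bsub>C\<^esub> f = idt C X" "f \<cdot>\<^bsub>C\<^esub> g = idt C Y"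
  shows "iso_arr C f"
  using assms by (auto simp: iso_arr_def homs_def)

context category
begin

lemma isomorphic_objs: "isomorphic C X Y \<Longrightarrow> X \<in> obj C \<and> Y \<in> obj C"
  using homs_obj by (auto simp: isomorphic_iff)

lemma isomorphic_refl: "X \<in> obj C \<Longrightarrow> isomorphic C X X"
  unfolding isomorphic_iff by (metis idt_homs cmp_idt)

lemma isomorphic_sym: "isomorphic C X Y \<Longrightarrow> isomorphic C Y X"
  unfolding isomorphic_iff by blast

lemma isomorphic_trans:
  assumes "isomorphic C X Y" "isomorphic C Y Z"
  shows "isomorphic C X Z"
proof -
  obtain f f' where f: "f \<in> homs C X Y" "f' \<in> homs C Y X" "f' \<cdot> f = idt C X" "f \<cdot> f' = idt C Y"
    using assms(1) by (auto simp: isomorphic_iff)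
  obtain g g' where g: "g \<in> homs C Y Z" "g' \<in> homs C Z Y" "g' \<cdot> g = idt C Y" "g \<cdot> g' = idt C Z"
    using assms(2) by (auto simp: isomorphic_iff)
  have "(f' \<cdot> g') \<cdot> (g \<cdot> f) = f' \<cdot> ((g' \<cdot> g) \<cdot> f)"
    using cmp_assoc[OF cmp_homs[OF f(1) g(1)] g(2) f(2)] cmp_assoc[OF f(1) g(1) g(2)] by simp
  also have "\<dots> = idt C X" using f g idt_cmp by metis
  finally have 1: "(f' \<cdot> g') \<cdot> (g \<cdot> f) = idt C X" .
  have "(g \<cdot> f) \<cdot> (f' \<cdot> g') = g \<cdot> ((f \<cdot> f') \<cdot> g')"
    using cmp_assoc[OF cmp_homs[OF g(2) f(2)] f(1) g(1)] cmp_assoc[OF g(2) f(2) f(1)] by simp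
  also have "\<dots> = idt C Z" using f g idt_cmp by metis
  finally have 2: "(g \<cdot> f) \<cdot> (f' \<cdot> g') = idt C Z" .
  show ?thesis unfolding isomorphic_iff using 1 2 f g cmp_homs by meson
qed

lemma iso_closedD: "iso_closed C S \<Longrightarrow> X \<in> S \<Longrightarrow> isomorphic C X Y \<Longrightarrow> Y \<in> S"
  using isomorphic_objs by (auto simp: iso_closed_def)

end

lemma hom_group_simps:
  "carrier (hom_group C X Y) = homs C X Y"
  "mult (hom_group C X Y) = plus_arr C"
  "one (hom_group C X Y) = zero_arr C X Y"
  by (simp_all add: hom_group_def)

context additive_category
begin

lemma zero_homs: "\<lbrakk>X \<in> obj C; Y \<in> obj C\<rbrakk> \<Longrightarrow> zero_arr C X Y \<in> homs C X Y"
  using monoid.one_closed[OF comm_group.axioms(1)[THEN comm_monoid.axioms(1), OF hom_comm_group]]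
  by (simp add: hom_group_def)

lemma plus_zero: "f \<in> homs C X Y \<Longrightarrow> plus_arr C f (zero_arr C X Y) = f"
proof -
  assume f: "f \<in> homs C X Y"
  interpret comm_group "hom_group C X Y" using f homs_obj hom_comm_group by blast
  show ?thesis using r_one f by (simp add: hom_group_def)
qed

lemma plus_homs: "\<lbrakk>f \<in> homs C X Y; g \<in> homs C X Y\<rbrakk> \<Longrightarrow> plus_arr C f g \<in> homs C X Y"
proof -
  assume f: "f \<in> homs C X Y" "g \<in> homs C X Y"
  interpret comm_group "hom_group C X Y" using f homs_obj hom_comm_group by blast
  show ?thesis using m_closed f by (simp add: hom_group_def)
qed

lemma neg_homs: "f \<in> homs C X Y \<Longrightarrow> neg_arr C f \<in> homs C X Y"
proof -
  assume f: "f \<in> homs C X Y"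
  interpret comm_group "hom_group C X Y" using f homs_obj hom_comm_group by blast
  show ?thesis using inv_closed[of f] f homsD[OF f] by (simp add: neg_arr_def hom_group_simps)
qed

lemma plus_eq_zero_iff:
  assumes f: "f \<in> homs C X Y" "g \<in> homs C X Y"
  shows "plus_arr C f g = zero_arr C X Y \<longleftrightarrow> f = neg_arr C g"
proof -
  interpret comm_group "hom_group C X Y" using f homs_obj hom_comm_group by blast
  have "f \<otimes>\<^bsub>hom_group C X Y\<^esub> g = \<one>\<^bsub>hom_group C X Y\<^esub> \<longleftrightarrow> f = inv\<^bsub>hom_group C X Y\<^esub> g"
    using f inv_equality[of f g] l_inv[of g] by (auto simp: hom_group_simps(1))
  then show ?thesis using homsD[OF f(2)] by (simp add: neg_arr_def hom_group_simps)
qed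

lemma plus_commute: 
  assumes f: "f \<in> homs C X Y" "g \<in> homs C X Y"
  shows "plus_arr C f g = plus_arr C g f"
proof -
  interpret comm_group "hom_group C X Y" using f homs_obj hom_comm_group by blast
  show ?thesis using m_comm[of f g] f by (simp add: hom_group_def)
qed

lemma plus_neg: "f \<in> homs C X Y \<Longrightarrow> plus_arr C f (neg_arr C f) = zero_arr C X Y"
  using plus_eq_zero_iff[of "neg_arr C f" X Y f] neg_homs plus_commute by metis

lemma neg_neg: "f \<in> homs C X Y \<Longrightarrow> neg_arr C (neg_arr C f) = f"
  using plus_eq_zero_iff[of f X Y "neg_arr C f"] neg_homs plus_neg by metis

lemma idem_zero: 
  assumes f: "f \<in> homs C X Y" and "plus_arr C f f = f"
  shows "f = zero_arr C X Y"
proof -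
  interpret comm_group "hom_group C X Y" using f homs_obj hom_comm_group by blast
  show ?thesis using r_cancel_one[of f f] assms by (simp add: hom_group_def)
qed

lemma cmp_zero_right:
  assumes "g \<in> homs C Y Z" "X \<in> obj C"
  shows "g \<cdot> zero_arr C X Y = zero_arr C X Z"
proof (rule idem_zero)
  have z: "zero_arr C X Y \<in> homs C X Y" using assms homs_obj zero_homs by blast
  show "g \<cdot> zero_arr C X Y \<in> homs C X Z" using z assms cmp_homs by blast
  show "plus_arr C (g \<cdot> zero_arr C X Y) (g \<cdot> zero_arr C X Y) = g \<cdot> zero_arr C X Y"
    using cmp_plus_right[OF z z assms(1)] plus_zero[OF z] by simp
qed

lemma cmp_zero_left:
  assumes "f \<in> homs C X Y" "Z \<in> obj C"
  shows "zero_arr C Y Z \<cdot> f = zero_arr C X Z"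
proof (rule idem_zero)
  have z: "zero_arr C Y Z \<in> homs C Y Z" using assms homs_obj zero_homs by blast
  show "zero_arr C Y Z \<cdot> f \<in> homs C X Z" using z assms cmp_homs by blast
  show "plus_arr C (zero_arr C Y Z \<cdot> f) (zero_arr C Y Z \<cdot> f) = zero_arr C Y Z \<cdot> f"
    using cmp_plus_left[OF assms(1) z z] plus_zero[OF z] by simp
qed

lemma cmp_neg_right:
  assumes "f \<in> homs C X Y" "g \<in> homs C Y Z"
  shows "g \<cdot> neg_arr C f = neg_arr C (g \<cdot> f)"
proof -
  have "plus_arr C (g \<cdot> neg_arr C f) (g \<cdot> f) = g \<cdot> plus_arr C (neg_arr C f) f"
    using cmp_plus_right assms neg_homs by metis
  also have "\<dots> = zero_arr C X Z"
    using assms plus_neg plus_commute neg_homs cmp_zero_right homs_obj by metis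
  finally show ?thesis using plus_eq_zero_iff assms neg_homs cmp_homs by metis
qed

lemma cmp_neg_left:
  assumes "f \<in> homs C X Y" "g \<in> homs C Y Z"
  shows "neg_arr C g \<cdot> f = neg_arr C (g \<cdot> f)"
proof -
  have "plus_arr C (neg_arr C g \<cdot> f) (g \<cdot> f) = plus_arr C (neg_arr C g) g \<cdot> f"
    using cmp_plus_left assms neg_homs by metis
  also have "\<dots> = zero_arr C X Z"
    using assms plus_neg plus_commute neg_homs cmp_zero_left homs_obj by metis
  finally show ?thesis using plus_eq_zero_iff assms neg_homs cmp_homs by metis
qed

lemma cmp_right_cancel_iff:
  assumes "u \<in> homs C X Y" "v \<in> homs C X Y" "g \<in> homs C Y Z"
  shows "g \<cdot> plus_arr C u (neg_arr C v) = zero_arr C X Z \<longleftrightarrow> g \<cdot> u = g \<cdot> v"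
  using cmp_plus_right[OF assms(1) neg_homs[OF assms(2)] assms(3)] cmp_neg_right[OF assms(2,3)]
    plus_eq_zero_iff[OF cmp_homs[OF assms(1,3)] neg_homs[OF cmp_homs[OF assms(2,3)]]]
    neg_neg[OF cmp_homs[OF assms(2,3)]] by metis

lemma cmp_left_cancel_iff:
  assumes "u \<in> homs C Y Z" "v \<in> homs C Y Z" "f \<in> homs C X Y"
  shows "plus_arr C u (neg_arr C v) \<cdot> f = zero_arr C X Z \<longleftrightarrow> u \<cdot> f = v \<cdot> f"
  using cmp_plus_left[OF assms(3) assms(1) neg_homs[OF assms(2)]] cmp_neg_left[OF assms(3,2)]
    plus_eq_zero_iff[OF cmp_homs[OF assms(3,1)] neg_homs[OF cmp_homs[OF assms(3,2)]]]
    neg_neg[OF cmp_homs[OF assms(3,2)]] by metis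

lemma diff_eq_zero_iff:
  assumes "u \<in> homs C X Y" "v \<in> homs C X Y"
  shows "plus_arr C u (neg_arr C v) = zero_arr C X Y \<longleftrightarrow> u = v"
  using plus_eq_zero_iff[OF assms(1) neg_homs[OF assms(2)]] neg_neg assms by metis

definition hom_zero :: "'a \<Rightarrow> 'a \<Rightarrow> bool" where
  "hom_zero X Y \<longleftrightarrow> homs C X Y \<subseteq> {zero_arr C X Y}"

lemma hom_zeroD: "hom_zero X Y \<Longrightarrow> f \<in> homs C X Y \<Longrightarrow> f = zero_arr C X Y"
  by (auto simp: hom_zero_def)

lemma hom_zero_iff:
  "\<lbrakk>X \<in> obj C; Y \<in> obj C\<rbrakk> \<Longrightarrow> hom_zero X Y \<longleftrightarrow> homs C X Y = {zero_arr C X Y}"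
  using zero_homs by (auto simp: hom_zero_def)

text \<open>
  All subcategories below are closed under isomorphisms, but objects are desuspended only up to
  isomorphism; this transports vanishing along the choice.
\<close>

lemma hom_zero_iso:
  assumes "hom_zero X Y" "isomorphic C X X'" "isomorphic C Y Y'"
  shows "hom_zero X' Y'"
  unfolding hom_zero_def
proof
  fix u assume u: "u \<in> homs C X' Y'"
  obtain f f' where f: "f \<in> homs C X X'" "f' \<in> homs C X' X" "f \<cdot> f' = idt C X'"
    using assms(2) by (auto simp: isomorphic_iff)
  obtain g g' where g: "g \<in> homs C Y Y'" "g' \<in> homs C Y' Y" "g \<cdot> g' = idt C Y'"
    using assms(3) by (auto simp: isomorphic_iff)
  have *: "g' \<cdot> (u \<cdot> f) \<in> homs C X Y" using u f g cmp_homs by metis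
  have uf: "u \<cdot> f \<in> homs C X Y'" using u f cmp_homs by metis
  have "g \<cdot> (g' \<cdot> (u \<cdot> f)) = u \<cdot> f"
    using cmp_assoc[OF uf g(2,1)] g(3) idt_cmp[OF uf] by simp
  then have "u = (g \<cdot> (g' \<cdot> (u \<cdot> f))) \<cdot> f'"
    using cmp_assoc[OF f(2,1) u] f(3) cmp_idt[OF u] by simp
  also have "\<dots> = zero_arr C X' Y'"
    using hom_zeroD[OF assms(1) *] f g cmp_zero_left cmp_zero_right homs_obj by metis
  finally show "u \<in> {zero_arr C X' Y'}" by simp
qed

lemma zero_object_homs:
  assumes "zero_object C Z" "X \<in> obj C"
  shows "hom_zero X Z" "hom_zero Z X"
  using assms zero_homs unfolding hom_zero_def zero_object_def by blast+

lemma zero_objectI: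
  assumes "Z \<in> obj C" "idt C Z = zero_arr C Z Z"
  shows "zero_object C Z"
proof -
  have "\<exists>!f. f \<in> homs C X Z" if "X \<in> obj C" for X
  proof
    show "zero_arr C X Z \<in> homs C X Z" using zero_homs that assms by blast
    show "f = zero_arr C X Z" if "f \<in> homs C X Z" for f
      using that assms idt_cmp cmp_zero_left homs_obj by metis
  qed
  moreover have "\<exists>!f. f \<in> homs C Z X" if "X \<in> obj C" for X
  proof
    show "zero_arr C Z X \<in> homs C Z X" using zero_homs that assms by blast
    show "f = zero_arr C Z X" if "f \<in> homs C Z X" for f
      using that assms cmp_idt cmp_zero_right homs_obj by metis
  qed
  ultimately show ?thesis using assms by (auto simp: zero_object_def)
qed

end

section \<open>Translation\<close>

context translation_category
begin

lemma sig_homs: "f \<in> homs C X Y \<Longrightarrow> sig_arr C f \<in> homs C (sig_obj C X) (sig_obj C Y)"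
  using bij_betwE[OF sig_fully_faithful[of X Y]] homs_obj[of f X Y] by simp

lemma sig_inj: "\<lbrakk>u \<in> homs C X Y; v \<in> homs C X Y; sig_arr C u = sig_arr C v\<rbrakk> \<Longrightarrow> u = v"
  using sig_fully_faithful[of X Y] homs_obj[of u X Y]
  by (simp add: bij_betw_def inj_on_def)

lemma sig_full:
  assumes "X \<in> obj C" "Y \<in> obj C" "w \<in> homs C (sig_obj C X) (sig_obj C Y)"
  obtains u where "u \<in> homs C X Y" "sig_arr C u = w"
proof -
  have "w \<in> sig_arr C ` homs C X Y"
    using bij_betw_imp_surj_on[OF sig_fully_faithful[OF assms(1,2)]] assms(3) by simp
  then show ?thesis using that by (elim imageE) simp
qed

lemma sig_zero:
  assumes "X \<in> obj C" "Y \<in> obj C"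
  shows "sig_arr C (zero_arr C X Y) = zero_arr C (sig_obj C X) (sig_obj C Y)"
proof (rule idem_zero)
  have z: "zero_arr C X Y \<in> homs C X Y" using assms zero_homs by blast
  show "sig_arr C (zero_arr C X Y) \<in> homs C (sig_obj C X) (sig_obj C Y)" using z sig_homs by blast
  show "plus_arr C (sig_arr C (zero_arr C X Y)) (sig_arr C (zero_arr C X Y))
      = sig_arr C (zero_arr C X Y)"
    using sig_plus[OF z z] plus_zero[OF z] by simp
qed

lemma isomorphic_sig_iff:
  assumes XY: "X \<in> obj C" "Y \<in> obj C"
  shows "isomorphic C (sig_obj C X) (sig_obj C Y) \<longleftrightarrow> isomorphic C X Y"
proof
  assume "isomorphic C X Y"
  then obtain f g where f: "f \<in> homs C X Y" "g \<in> homs C Y X"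
    "g \<cdot> f = idt C X" "f \<cdot> g = idt C Y" by (auto simp: isomorphic_iff)
  have "sig_arr C g \<cdot> sig_arr C f = idt C (sig_obj C X)"
    "sig_arr C f \<cdot> sig_arr C g = idt C (sig_obj C Y)"
    using f sig_cmp sig_idt XY by metis+
  then show "isomorphic C (sig_obj C X) (sig_obj C Y)"
    using f sig_homs unfolding isomorphic_iff by blast
next
  assume "isomorphic C (sig_obj C X) (sig_obj C Y)"
  then obtain f g where f: "f \<in> homs C (sig_obj C X) (sig_obj C Y)"
    "g \<in> homs C (sig_obj C Y) (sig_obj C X)"
    "g \<cdot> f = idt C (sig_obj C X)" "f \<cdot> g = idt C (sig_obj C Y)" by (auto simp: isomorphic_iff)
  obtain f' where f': "f' \<in> homs C X Y" "sig_arr C f' = f" using sig_full XY f by metis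
  obtain g' where g': "g' \<in> homs C Y X" "sig_arr C g' = g" using sig_full XY f by metis
  have "g' \<cdot> f' = idt C X"
    by (rule sig_inj[OF cmp_homs[OF f'(1) g'(1)] idt_homs[OF XY(1)]])
      (simp add: sig_cmp[OF f'(1) g'(1)] f' g' f sig_idt XY)
  moreover have "f' \<cdot> g' = idt C Y"
    by (rule sig_inj[OF cmp_homs[OF g'(1) f'(1)] idt_homs[OF XY(2)]])
      (simp add: sig_cmp[OF g'(1) f'(1)] f' g' f sig_idt XY)
  ultimately show "isomorphic C X Y" using f' g' unfolding isomorphic_iff by blast
qed

lemma hom_zero_sig_iff:
  assumes XY: "X \<in> obj C" "Y \<in> obj C"
  shows "hom_zero (sig_obj C X) (sig_obj C Y) \<longleftrightarrow> hom_zero X Y"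
proof
  assume *: "hom_zero (sig_obj C X) (sig_obj C Y)"
  show "hom_zero X Y" unfolding hom_zero_def
  proof
    fix f assume f: "f \<in> homs C X Y"
    have "sig_arr C f = sig_arr C (zero_arr C X Y)"
      using hom_zeroD[OF * sig_homs[OF f]] sig_zero XY by simp
    then show "f \<in> {zero_arr C X Y}" using sig_inj[OF f zero_homs[OF XY]] by simp
  qed
next
  assume *: "hom_zero X Y"
  show "hom_zero (sig_obj C X) (sig_obj C Y)" unfolding hom_zero_def
  proof
    fix f assume f: "f \<in> homs C (sig_obj C X) (sig_obj C Y)"
    then obtain u where "u \<in> homs C X Y" "sig_arr C u = f" using sig_full XY by metis
    then show "f \<in> {zero_arr C (sig_obj C X) (sig_obj C Y)}"
      using hom_zeroD[OF *] sig_zero XY by auto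
  qed
qed

lemma zero_object_sig:
  assumes "zero_object C Z"
  shows "zero_object C (sig_obj C Z)"
proof (rule zero_objectI)
  have Z: "Z \<in> obj C" using assms by (simp add: zero_object_def)
  show "sig_obj C Z \<in> obj C" using Z sig_obj_obj by blast
  have "idt C Z = zero_arr C Z Z"
    using hom_zeroD[OF zero_object_homs(1)[OF assms Z] idt_homs[OF Z]] .
  then show "idt C (sig_obj C Z) = zero_arr C (sig_obj C Z) (sig_obj C Z)"
    using sig_idt sig_zero Z by metis
qed

text \<open>
  \<open>\<Sigma>\<close> is only essentially surjective, so this replaces the choice of a desuspension.
\<close>

lemma isomorphic_to_sig:
  assumes "Y \<in> obj C"
  obtains X where "X \<in> obj C" "isomorphic C Y (sig_obj C X)"
  using sig_ess_surj[OF assms] isomorphic_sym by blast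

lemma sig_pow_obj: "X \<in> obj C \<Longrightarrow> (sig_obj C ^^ n) X \<in> obj C"
  by (induction n) (auto simp: sig_obj_obj)

lemma isomorphic_sig_pow: "isomorphic C X Y \<Longrightarrow> isomorphic C ((sig_obj C ^^ n) X) ((sig_obj C ^^ n) Y)"
proof (induction n)
  case (Suc n)
  then have "isomorphic C ((sig_obj C ^^ n) X) ((sig_obj C ^^ n) Y)" by simp
  then show ?case using isomorphic_sig_iff[of "(sig_obj C ^^ n) X" "(sig_obj C ^^ n) Y"]
      isomorphic_objs[of "(sig_obj C ^^ n) X" "(sig_obj C ^^ n) Y"] by simp
qed simp

section \<open>Shifted subcategories\<close>

lemma shift_subset_obj: "shift C n S \<subseteq> obj C"
  by (auto simp: shift_def)

lemma shift_mono: "S \<subseteq> R \<Longrightarrow> shift C n S \<subseteq> shift C n R"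
  by (auto simp: shift_def)

lemma shift_minus_one: "shift C (- 1) S = {X \<in> obj C. sig_obj C X \<in> S}"
  by (simp add: shift_def)

lemma shift_one: "shift C 1 S = {X \<in> obj C. \<exists>Y \<in> S. isomorphic C (sig_obj C Y) X}"
  by (simp add: shift_def)

lemma iso_closed_shift:
  assumes "iso_closed C S"
  shows "iso_closed C (shift C n S)"
proof -
  have "Y \<in> shift C n S" if XS: "X \<in> shift C n S" and XY: "isomorphic C X Y" for X Y
  proof (cases "n \<ge> 0")
    case True
    then obtain Z where Z: "Z \<in> S" "isomorphic C ((sig_obj C ^^ nat n) Z) X"
      using XS by (auto simp: shift_def)
    show ?thesis
      using True Z(1) isomorphic_trans[OF Z(2) XY] isomorphic_objs[OF XY] by (auto simp: shift_def)
  next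
    case False
    then show ?thesis
      using XS iso_closedD[OF assms _ isomorphic_sig_pow[OF XY, of "nat (- n)"]]
        isomorphic_objs[OF XY]
      by (simp add: shift_def)
  qed
  then show ?thesis using shift_subset_obj by (auto simp: iso_closed_def)
qed

lemma shift_zero: "iso_closed C S \<Longrightarrow> shift C 0 S = S"
proof -
  assume S: "iso_closed C S"
  have "shift C 0 S = {X \<in> obj C. \<exists>Y \<in> S. isomorphic C Y X}" by (simp add: shift_def)
  moreover have "S \<subseteq> obj C" using S by (simp add: iso_closed_def)
  ultimately show ?thesis using isomorphic_refl iso_closedD[OF S] by blast
qed

lemma shift_minus_one_one:
  assumes "iso_closed C S"
  shows "shift C (- 1) (shift C 1 S) = S"
proof -
  have S: "S \<subseteq> obj C" using assms by (simp add: iso_closed_def)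
  have "X \<in> S" if "X \<in> obj C" "Y \<in> S" "isomorphic C (sig_obj C Y) (sig_obj C X)" for X Y
    using that S isomorphic_sig_iff iso_closedD[OF assms] by blast
  moreover have "isomorphic C (sig_obj C X) (sig_obj C X)" if "X \<in> S" for X
    using that S isomorphic_refl sig_obj_obj by blast
  ultimately show ?thesis using S sig_obj_obj unfolding shift_minus_one shift_one by blast
qed

lemma shift_one_minus_one:
  assumes "iso_closed C S"
  shows "shift C 1 (shift C (- 1) S) = S"
proof -
  have S: "S \<subseteq> obj C" using assms by (simp add: iso_closed_def)
  have "X \<in> shift C 1 (shift C (- 1) S)" if X: "X \<in> S" for X
  proof -
    obtain Y where Y: "Y \<in> obj C" "isomorphic C X (sig_obj C Y)"
      using isomorphic_to_sig X S by blast
    then have "isomorphic C (sig_obj C Y) X" "sig_obj C Y \<in> S"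
      using iso_closedD[OF assms X Y(2)] isomorphic_sym by auto
    then show ?thesis using X S Y(1) unfolding shift_minus_one shift_one by blast
  qed
  moreover have "X \<in> S" if "X \<in> shift C 1 (shift C (- 1) S)" for X
    using iso_closedD[OF assms] that unfolding shift_minus_one shift_one by blast
  ultimately show ?thesis by blast
qed

lemma shift_Suc_pos:
  assumes "iso_closed C S"
  shows "shift C (int n + 1) S = shift C 1 (shift C (int n) S)"
proof -
  have S: "S \<subseteq> obj C" using assms by (simp add: iso_closed_def)
  have e: "nat (int n + 1) = Suc n" by simp
  have "X \<in> shift C (int n + 1) S \<longleftrightarrow> X \<in> shift C 1 (shift C (int n) S)" for X
  proof
    assume "X \<in> shift C (int n + 1) S"
    then obtain Y where Y: "Y \<in> S" "isomorphic C ((sig_obj C ^^ Suc n) Y) X" "X \<in> obj C"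
      by (auto simp: shift_def e)
    moreover have "(sig_obj C ^^ n) Y \<in> shift C (int n) S"
      using Y(1) S sig_pow_obj[of Y n] isomorphic_refl[of "(sig_obj C ^^ n) Y"]
      by (auto simp: shift_def)
    ultimately show "X \<in> shift C 1 (shift C (int n) S)" by (auto simp: shift_one)
  next
    assume "X \<in> shift C 1 (shift C (int n) S)"
    then obtain Z where Z: "Z \<in> shift C (int n) S" "isomorphic C (sig_obj C Z) X" "X \<in> obj C"
      unfolding shift_one by blast
    then obtain Y where "Y \<in> S" "isomorphic C ((sig_obj C ^^ n) Y) Z" by (auto simp: shift_def)
    with Z have Y: "Y \<in> S" "isomorphic C ((sig_obj C ^^ n) Y) Z"
      "isomorphic C (sig_obj C Z) X" "X \<in> obj C" by auto
    have "isomorphic C ((sig_obj C ^^ Suc n) Y) (sig_obj C Z)"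
      using isomorphic_sig_iff[of "(sig_obj C ^^ n) Y" Z] isomorphic_objs[OF Y(2)] Y(2) by simp
    then have "isomorphic C ((sig_obj C ^^ Suc n) Y) X" using Y isomorphic_trans by blast
    then show "X \<in> shift C (int n + 1) S" using Y by (auto simp: shift_def e)
  qed
  then show ?thesis by blast
qed

lemma shift_Suc_neg: "shift C (- int n - 1) S = shift C (- 1) (shift C (- int n) S)"
  if "iso_closed C S"
proof (cases "n = 0")
  case True
  then show ?thesis using shift_zero[OF that] by simp
next
  case False
  have e: "nat (1 + int n) = Suc n" by simp
  show ?thesis unfolding shift_minus_one using False
    by (auto simp: shift_def e funpow_swap1 sig_obj_obj)
qed

lemma shift_succ:
  assumes "iso_closed C S"
  shows "shift C (n + 1) S = shift C 1 (shift C n S)"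
proof (cases "n \<ge> 0")
  case True
  then show ?thesis using shift_Suc_pos[OF assms, of "nat n"] by simp
next
  case False
  then obtain k where k: "n = - int k - 1" by (intro that[of "nat (- n - 1)"]) simp
  show ?thesis
    using shift_Suc_neg[OF assms, of k] shift_one_minus_one[OF iso_closed_shift[OF assms]] k by simp
qed

lemma shift_pred:
  assumes "iso_closed C S"
  shows "shift C (n - 1) S = shift C (- 1) (shift C n S)"
  using shift_succ[OF assms, of "n - 1"] shift_minus_one_one[OF iso_closed_shift[OF assms]] by simp

text \<open>
  Negative shifts are preimages and positive shifts are closures of images. On subcategories closed
  under isomorphisms the shifts by \<open>1\<close> and \<open>- 1\<close> are mutually inverse, so all shifts form an action
  of the integers.
\<close>

lemma shift_shift:
  assumes "iso_closed C S"
  shows "shift C m (shift C n S) = shift C (m + n) S"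
proof (induction m rule: int_induct[of _ 0])
  case base
  show ?case using shift_zero iso_closed_shift assms by simp
next
  case (step1 i)
  then show ?case using shift_succ[OF iso_closed_shift[OF assms], of i n] shift_succ[OF assms, of "i + n"]
    by (simp add: algebra_simps)
next
  case (step2 i)
  then show ?case using shift_pred[OF iso_closed_shift[OF assms], of i n] shift_pred[OF assms, of "i + n"]
    by (simp add: algebra_simps)
qed

lemma shift_subset_iff:
  assumes "iso_closed C S" "iso_closed C R"
  shows "shift C n S \<subseteq> shift C n R \<longleftrightarrow> S \<subseteq> R"
  using shift_mono[of "shift C n S" "shift C n R" "- n"] shift_mono[of S R n]
  by (auto simp: shift_shift assms shift_zero)

lemma iso_closed_Int: "\<lbrakk>iso_closed C S; iso_closed C R\<rbrakk> \<Longrightarrow> iso_closed C (S \<inter> R)"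
  by (auto simp: iso_closed_def)

lemma shift_Int:
  assumes "iso_closed C S" "iso_closed C R"
  shows "shift C n (S \<inter> R) = shift C n S \<inter> shift C n R"
proof
  show "shift C n (S \<inter> R) \<subseteq> shift C n S \<inter> shift C n R" by (auto simp: shift_def)
  have c: "iso_closed C (shift C n S \<inter> shift C n R)" using iso_closed_Int iso_closed_shift assms by blast
  have "shift C (- n) (shift C n S \<inter> shift C n R) \<subseteq> S \<inter> R"
    using shift_mono[of "shift C n S \<inter> shift C n R" "shift C n S" "- n"]
      shift_mono[of "shift C n S \<inter> shift C n R" "shift C n R" "- n"]
    by (auto simp: shift_shift assms shift_zero)
  then have "shift C n (shift C (- n) (shift C n S \<inter> shift C n R)) \<subseteq> shift C n (S \<inter> R)"
    by (rule shift_mono)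
  then show "shift C n S \<inter> shift C n R \<subseteq> shift C n (S \<inter> R)" by (simp add: shift_shift c shift_zero)
qed

end

section \<open>Exact triangles\<close>

context triangulated_category
begin

definition exact_tri :: "'a \<Rightarrow> 'a \<Rightarrow> 'a \<Rightarrow> 'b \<Rightarrow> 'b \<Rightarrow> 'b \<Rightarrow> bool" where
  "exact_tri X Y Z f g h \<longleftrightarrow> (f, g, h) \<in> tri C \<and>
     f \<in> homs C X Y \<and> g \<in> homs C Y Z \<and> h \<in> homs C Z (sig_obj C X)"

text \<open>
  Most arguments only use that some exact triangle joins three objects. Forgetting its arrows
  makes rotation reversible without signs.
\<close>

definition extension :: "'a \<Rightarrow> 'a \<Rightarrow> 'a \<Rightarrow> bool" where
  "extension X Y Z \<longleftrightarrow> (\<exists>f g h. exact_tri X Y Z f g h)"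

lemma exact_triD:
  assumes "exact_tri X Y Z f g h"
  shows "(f, g, h) \<in> tri C" "f \<in> homs C X Y" "g \<in> homs C Y Z" "h \<in> homs C Z (sig_obj C X)"
    "X \<in> obj C" "Y \<in> obj C" "Z \<in> obj C"
  using assms homs_obj by (auto simp: exact_tri_def)

lemma extension_objs:
  assumes "extension X Y Z"
  shows "X \<in> obj C" "Y \<in> obj C" "Z \<in> obj C"
proof -
  obtain f g h where "exact_tri X Y Z f g h" using assms unfolding extension_def by blast
  from exact_triD(5-7)[OF this] show "X \<in> obj C" "Y \<in> obj C" "Z \<in> obj C" .
qed

lemma tri_exact_tri:
  assumes "(f, g, h) \<in> tri C"
  shows "exact_tri (src C f) (tgt C f) (tgt C g) f g h"
proof -
  have f: "f \<in> arr C" and g: "g \<in> homs C (tgt C f) (src C h)"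
    and h: "h \<in> homs C (tgt C g) (sig_obj C (src C f))"
    using tri_triangle[OF assms] unfolding triangle_def by auto
  have "g \<in> homs C (tgt C f) (tgt C g)" using g homsD[OF g] by simp
  moreover have "f \<in> homs C (src C f) (tgt C f)" using f by (simp add: homs_def)
  ultimately show ?thesis using h assms by (simp add: exact_tri_def)
qed

lemma triangleI:
  "\<lbrakk>f \<in> homs C X Y; g \<in> homs C Y Z; h \<in> homs C Z (sig_obj C X)\<rbrakk> \<Longrightarrow> triangle C f g h"
  by (simp add: triangle_def homs_def)

lemma exact_tri_rotate_iff:
  assumes "f \<in> homs C X Y" "g \<in> homs C Y Z" "h \<in> homs C Z (sig_obj C X)"
  shows "exact_tri X Y Z f g h \<longleftrightarrow> exact_tri Y Z (sig_obj C X) g h (neg_arr C (sig_arr C f))"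
  using assms TR2[OF triangleI[OF assms]] neg_homs[OF sig_homs[OF assms(1)]]
  by (simp add: exact_tri_def)

lemma exact_tri_rotate:
  assumes "exact_tri X Y Z f g h"
  shows "exact_tri Y Z (sig_obj C X) g h (neg_arr C (sig_arr C f))"
  using exact_tri_rotate_iff[OF exact_triD(2-4)[OF assms]] assms by simp

text \<open>
  Backwards, the third arrow of the rotated triangle has the form \<open>- \<Sigma> f\<close> because \<open>\<Sigma>\<close> is full, and
  the rotation axiom is an equivalence.
\<close>

lemma extension_rotate_iff:
  assumes "X \<in> obj C" "Y \<in> obj C"
  shows "extension X Y Z \<longleftrightarrow> extension Y Z (sig_obj C X)"
proof
  assume "extension X Y Z"
  then obtain f g h where "exact_tri X Y Z f g h" unfolding extension_def by blast
  from exact_tri_rotate[OF this] show "extension Y Z (sig_obj C X)" unfolding extension_def by blast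
next
  assume "extension Y Z (sig_obj C X)"
  then obtain g h k where t: "exact_tri Y Z (sig_obj C X) g h k" unfolding extension_def by blast
  have k: "k \<in> homs C (sig_obj C X) (sig_obj C Y)" using exact_triD(4)[OF t] .
  obtain f where f: "f \<in> homs C X Y" "sig_arr C f = neg_arr C k"
    using sig_full[OF assms neg_homs[OF k]] .
  have "neg_arr C (sig_arr C f) = k" using neg_neg[OF k] f by simp
  then have "exact_tri X Y Z f g h"
    using exact_tri_rotate_iff[OF f(1) exact_triD(2,3)[OF t]] t by simp
  then show "extension X Y Z" unfolding extension_def by blast
qed

text \<open>
  \<open>\<Sigma>\<close> preserves and reflects exact triangles up to signs: apply the rotation three times.
\<close>

lemma extension_sig_iff:
  assumes "X \<in> obj C" "Y \<in> obj C" "Z \<in> obj C"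
  shows "extension (sig_obj C X) (sig_obj C Y) (sig_obj C Z) \<longleftrightarrow> extension X Y Z"
  by (simp only: extension_rotate_iff[OF assms(1,2)] extension_rotate_iff[OF assms(2,3)]
      extension_rotate_iff[OF assms(3) sig_obj_obj[OF assms(1)]])

lemma extension_iso:
  assumes "extension X Y Z" "isomorphic C X X'" "isomorphic C Y Y'" "isomorphic C Z Z'"
  shows "extension X' Y' Z'"
proof -
  obtain f g h where t: "exact_tri X Y Z f g h" using assms(1) unfolding extension_def by blast
  note f = exact_triD(2)[OF t] and g = exact_triD(3)[OF t] and h = exact_triD(4)[OF t]
  obtain a a' where a: "a \<in> homs C X X'" "a' \<in> homs C X' X" "a' \<cdot> a = idt C X" "a \<cdot> a' = idt C X'"
    using assms(2) by (auto simp: isomorphic_iff)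
  obtain b b' where b: "b \<in> homs C Y Y'" "b' \<in> homs C Y' Y" "b' \<cdot> b = idt C Y" "b \<cdot> b' = idt C Y'"
    using assms(3) by (auto simp: isomorphic_iff)
  obtain c c' where c: "c \<in> homs C Z Z'" "c' \<in> homs C Z' Z" "c' \<cdot> c = idt C Z" "c \<cdot> c' = idt C Z'"
    using assms(4) by (auto simp: isomorphic_iff)
  have f': "b \<cdot> (f \<cdot> a') \<in> homs C X' Y'" using cmp_homs[OF cmp_homs[OF a(2) f] b(1)] .
  have g': "c \<cdot> (g \<cdot> b') \<in> homs C Y' Z'" using cmp_homs[OF cmp_homs[OF b(2) g] c(1)] .
  have h': "sig_arr C a \<cdot> (h \<cdot> c') \<in> homs C Z' (sig_obj C X')"
    using cmp_homs[OF cmp_homs[OF c(2) h] sig_homs[OF a(1)]] .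
  have conj: "(v \<cdot> (k \<cdot> u')) \<cdot> u = v \<cdot> k"
    if "k \<in> homs C P Q" "u \<in> homs C P P'" "u' \<in> homs C P' P" "u' \<cdot> u = idt C P" "v \<in> homs C Q Q'"
    for k u u' v P Q P' Q'
    using cmp_assoc[OF that(2) cmp_homs[OF that(3,1)] that(5)] cmp_assoc[OF that(2,3,1)]
      cmp_idt[OF that(1)] that(4) by simp
  have "triangle_morphism C (f, g, h) (b \<cdot> (f \<cdot> a'), c \<cdot> (g \<cdot> b'), sig_arr C a \<cdot> (h \<cdot> c')) a b c"
    using a(1) b(1) c(1) conj[OF f a(1,2,3) b(1)] conj[OF g b(1,2,3) c(1)]
      conj[OF h c(1,2,3) sig_homs[OF a(1)]]
      homsD[OF f] homsD[OF g] homsD[OF h] homsD[OF f'] homsD[OF g'] homsD[OF h']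
    by (simp add: triangle_morphism_def)
  then have "(b \<cdot> (f \<cdot> a'), c \<cdot> (g \<cdot> b'), sig_arr C a \<cdot> (h \<cdot> c')) \<in> tri C"
    using TR1a[OF exact_triD(1)[OF t] triangleI[OF f' g' h']] iso_arrI[OF a] iso_arrI[OF b]
      iso_arrI[OF c] by simp
  then show ?thesis using f' g' h' unfolding extension_def exact_tri_def by meson
qed

lemma exact_tri_idt:
  assumes "X \<in> obj C" "zero_object C Z"
  shows "exact_tri X X Z (idt C X) (zero_arr C X Z) (zero_arr C Z (sig_obj C X))"
proof -
  have Z: "Z \<in> obj C" using assms by (simp add: zero_object_def)
  show ?thesis using TR1b[OF assms] idt_homs[OF assms(1)] zero_homs[OF assms(1) Z]
    zero_homs[OF Z sig_obj_obj[OF assms(1)]] by (simp add: exact_tri_def)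
qed

lemma extension_zero_right: "\<lbrakk>X \<in> obj C; zero_object C Z\<rbrakk> \<Longrightarrow> extension X X Z"
  using exact_tri_idt unfolding extension_def by blast

lemma extension_zero_left:
  assumes "X \<in> obj C" "zero_object C Z"
  shows "extension Z X X"
  using extension_rotate_iff[of Z X X] extension_zero_right[OF assms(1) zero_object_sig[OF assms(2)]]
    assms by (simp add: zero_object_def)

lemma exact_tri_from_zero:
  assumes "W \<in> obj C" "zero_object C Z"
  shows "exact_tri Z W W (zero_arr C Z W) (idt C W) (zero_arr C W (sig_obj C Z))"
proof -
  have Z: "Z \<in> obj C" using assms by (simp add: zero_object_def)
  have z: "zero_object C (sig_obj C Z)" using zero_object_sig assms by blast
  have "neg_arr C (sig_arr C (zero_arr C Z W)) = zero_arr C (sig_obj C Z) (sig_obj C W)"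
    using hom_zeroD[OF zero_object_homs(2)[OF z sig_obj_obj[OF assms(1)]]
      neg_homs[OF sig_homs[OF zero_homs[OF Z assms(1)]]]] .
  then show ?thesis
    using exact_tri_rotate_iff[OF zero_homs[OF Z assms(1)] idt_homs[OF assms(1)]
        zero_homs[OF assms(1) sig_obj_obj[OF Z]]] exact_tri_idt[OF assms(1) z] by simp
qed

text \<open>
  Exactness of \<open>Hom(-, W)\<close>: \<open>v\<close> and the zero arrow extend to a morphism into the triangle
  \<open>0 \<rightarrow> W \<rightarrow> W \<rightarrow> 0\<close>.
\<close>

lemma exact_tri_contravariant:
  assumes t: "exact_tri X Y Z f g h" and v: "v \<in> homs C Y W" "v \<cdot> f = zero_arr C X W"
  obtains w where "w \<in> homs C Z W" "v = w \<cdot> g"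
proof -
  note f = exact_triD(2)[OF t] and g = exact_triD(3)[OF t] and h = exact_triD(4)[OF t]
  obtain E where E: "zero_object C E" using ex_zero_object by blast
  have W: "W \<in> obj C" and Eo: "E \<in> obj C" using homs_obj[OF v(1)] E by (auto simp: zero_object_def)
  note t' = exact_tri_from_zero[OF W E]
  have z: "zero_arr C X E \<in> homs C X E" using zero_homs exact_triD(5)[OF t] Eo by blast
  have "v \<cdot> f = zero_arr C E W \<cdot> zero_arr C X E" using v(2) cmp_zero_left[OF z W] by simp
  then obtain c where "triangle_morphism C (f, g, h)
      (zero_arr C E W, idt C W, zero_arr C W (sig_obj C E)) (zero_arr C X E) v c"
    using TR3[OF exact_triD(1)[OF t] exact_triD(1)[OF t']] z v(1) homsD[OF f]
      homsD[OF exact_triD(2)[OF t']] by auto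
  then have "c \<in> homs C Z W" "c \<cdot> g = idt C W \<cdot> v"
    using homsD[OF h] homsD[OF exact_triD(4)[OF t']] by (auto simp: triangle_morphism_def)
  then show ?thesis using that idt_cmp[OF v(1)] by simp
qed

text \<open>
  Exactness of \<open>Hom(W, -)\<close>. The filling axiom produces third components, whereas the first one is
  wanted here; so compare the rotations of \<open>W \<rightarrow> W \<rightarrow> 0\<close> and of the given triangle, and remove \<open>\<Sigma>\<close>
  from the result by full faithfulness.
\<close>

lemma exact_tri_covariant:
  assumes t: "exact_tri X Y Z f g h" and u: "u \<in> homs C W Y" "g \<cdot> u = zero_arr C W Z"
  obtains w where "w \<in> homs C W X" "u = f \<cdot> w"
proof -
  note f = exact_triD(2)[OF t] and g = exact_triD(3)[OF t] and h = exact_triD(4)[OF t]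
  note X = exact_triD(5)[OF t] and Z = exact_triD(7)[OF t]
  obtain E where E: "zero_object C E" using ex_zero_object by blast
  have W: "W \<in> obj C" and Eo: "E \<in> obj C" using homs_obj[OF u(1)] E by (auto simp: zero_object_def)
  let ?n = "neg_arr C (sig_arr C (idt C W))"
  note t1 = exact_tri_rotate[OF exact_tri_idt[OF W E]]
  note t2 = exact_tri_rotate[OF t]
  have z: "zero_arr C E Z \<in> homs C E Z" using zero_homs Z Eo by blast
  have "zero_arr C E Z \<cdot> zero_arr C W E = g \<cdot> u"
    using u(2) cmp_zero_left[OF zero_homs[OF W Eo] Z] by simp
  then obtain c where "triangle_morphism C (zero_arr C W E, zero_arr C E (sig_obj C W), ?n)
      (g, h, neg_arr C (sig_arr C f)) u (zero_arr C E Z) c"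
    using TR3[OF exact_triD(1)[OF t1] exact_triD(1)[OF t2]] z u(1)
      homsD[OF exact_triD(2)[OF t1]] homsD[OF g] by auto
  then have c: "c \<in> homs C (sig_obj C W) (sig_obj C X)"
    and e: "sig_arr C u \<cdot> ?n = neg_arr C (sig_arr C f) \<cdot> c"
    using homsD[OF exact_triD(4)[OF t1]] homsD[OF exact_triD(4)[OF t2]]
    by (auto simp: triangle_morphism_def)
  obtain w where w: "w \<in> homs C W X" "sig_arr C w = c" using sig_full[OF W X c] .
  note su = sig_homs[OF u(1)] and sf = sig_homs[OF f] and iW = idt_homs[OF sig_obj_obj[OF W]]
  have "sig_arr C u \<cdot> ?n = neg_arr C (sig_arr C u)"
    using cmp_neg_right[OF iW su] cmp_idt[OF su] sig_idt[OF W] by simp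
  moreover have "neg_arr C (sig_arr C f) \<cdot> c = neg_arr C (sig_arr C (f \<cdot> w))"
    using cmp_neg_left[OF c sf] sig_cmp[OF w(1) f] w(2) by simp
  ultimately have "sig_arr C u = sig_arr C (f \<cdot> w)"
    using e neg_neg[OF su] neg_neg[OF sig_homs[OF cmp_homs[OF w(1) f]]] by metis
  then have "u = f \<cdot> w" using sig_inj[OF u(1) cmp_homs[OF w(1) f]] by simp
  then show ?thesis using that w(1) by blast
qed

lemma hom_zero_extension_left:
  assumes "extension X Y Z" "hom_zero X W" "hom_zero Z W"
  shows "hom_zero Y W"
  unfolding hom_zero_def
proof
  fix v assume v: "v \<in> homs C Y W"
  obtain f g h where t: "exact_tri X Y Z f g h" using assms(1) unfolding extension_def by blast
  have "v \<cdot> f = zero_arr C X W" using hom_zeroD[OF assms(2) cmp_homs[OF exact_triD(2)[OF t] v]] .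
  then obtain w where w: "w \<in> homs C Z W" "v = w \<cdot> g" using exact_tri_contravariant[OF t v] by blast
  then show "v \<in> {zero_arr C Y W}"
    using hom_zeroD[OF assms(3) w(1)] cmp_zero_left[OF exact_triD(3)[OF t]] homs_obj[OF v] by simp
qed

lemma hom_zero_extension_right:
  assumes "extension X Y Z" "hom_zero W X" "hom_zero W Z"
  shows "hom_zero W Y"
  unfolding hom_zero_def
proof
  fix v assume v: "v \<in> homs C W Y"
  obtain f g h where t: "exact_tri X Y Z f g h" using assms(1) unfolding extension_def by blast
  have "g \<cdot> v = zero_arr C W Z" using hom_zeroD[OF assms(3) cmp_homs[OF v exact_triD(3)[OF t]]] .
  then obtain w where w: "w \<in> homs C W X" "v = f \<cdot> w" using exact_tri_covariant[OF t v] by blast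
  then show "v \<in> {zero_arr C W Y}"
    using hom_zeroD[OF assms(2) w(1)] cmp_zero_right[OF exact_triD(2)[OF t]] homs_obj[OF v] by simp
qed

text \<open>
  The kernel of \<open>f \<cdot> -\<close> on \<open>Hom(W, X)\<close> is a quotient of \<open>Hom(\<Sigma> W, Z)\<close>. With \<open>exact_tri_epi\<close>, the dual
  fact, this gives the uniqueness parts in the universal properties of truncations.
\<close>

lemma exact_tri_mono:
  assumes t: "exact_tri X Y Z f g h" and h0: "hom_zero (sig_obj C W) Z"
    and u: "u \<in> homs C W X" and v: "v \<in> homs C W X" and e: "f \<cdot> u = f \<cdot> v"
  shows "u = v"
proof -
  note f = exact_triD(2)[OF t]
  note X = exact_triD(5)[OF t] and Y = exact_triD(6)[OF t]
  have W: "W \<in> obj C" using homs_obj[OF u] by simp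
  let ?d = "plus_arr C u (neg_arr C v)"
  have d: "?d \<in> homs C W X" using plus_homs[OF u neg_homs[OF v]] .
  note nf = neg_homs[OF sig_homs[OF f]]
  have "f \<cdot> ?d = zero_arr C W Y" using cmp_right_cancel_iff[OF u v f] e by simp
  then have "sig_arr C f \<cdot> sig_arr C ?d = zero_arr C (sig_obj C W) (sig_obj C Y)"
    using sig_cmp[OF d f] sig_zero[OF W Y] by simp
  then have "neg_arr C (sig_arr C f) \<cdot> sig_arr C ?d = neg_arr C (zero_arr C (sig_obj C W) (sig_obj C Y))"
    using cmp_neg_left[OF sig_homs[OF d] sig_homs[OF f]] by simp
  also have "\<dots> = zero_arr C (sig_obj C W) (sig_obj C Y)"
    using plus_eq_zero_iff[of "zero_arr C (sig_obj C W) (sig_obj C Y)" "sig_obj C W" "sig_obj C Y"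
      "zero_arr C (sig_obj C W) (sig_obj C Y)"] plus_zero zero_homs sig_obj_obj W Y by simp
  finally obtain w where w: "w \<in> homs C (sig_obj C W) Z" "sig_arr C ?d = h \<cdot> w"
    using exact_tri_covariant[OF exact_tri_rotate[OF exact_tri_rotate[OF t]] sig_homs[OF d]] by blast
  then have "sig_arr C ?d = sig_arr C (zero_arr C W X)"
    using hom_zeroD[OF h0 w(1)] cmp_zero_right[OF exact_triD(4)[OF t] sig_obj_obj[OF W]] sig_zero[OF W X]
    by simp
  then have "?d = zero_arr C W X" using sig_inj[OF d zero_homs[OF W X]] by simp
  then show ?thesis using diff_eq_zero_iff[OF u v] by simp
qed

lemma exact_tri_epi:
  assumes t: "exact_tri X Y Z f g h" and h0: "hom_zero (sig_obj C X) W"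
    and u: "u \<in> homs C Z W" and v: "v \<in> homs C Z W" and e: "u \<cdot> g = v \<cdot> g"
  shows "u = v"
proof -
  note g = exact_triD(3)[OF t] and h = exact_triD(4)[OF t]
  have W: "W \<in> obj C" using homs_obj[OF u] by simp
  let ?d = "plus_arr C u (neg_arr C v)"
  have d: "?d \<in> homs C Z W" using plus_homs[OF u neg_homs[OF v]] .
  have "?d \<cdot> g = zero_arr C Y W" using cmp_left_cancel_iff[OF u v g] e by simp
  then obtain w where w: "w \<in> homs C (sig_obj C X) W" "?d = w \<cdot> h"
    using exact_tri_contravariant[OF exact_tri_rotate[OF t] d] by blast
  then have "?d = zero_arr C Z W" using hom_zeroD[OF h0 w(1)] cmp_zero_left[OF h W] by simp
  then show ?thesis using diff_eq_zero_iff[OF u v] by simp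
qed

text \<open>
  The octahedral axiom for \<open>S \<rightarrow> Y \<rightarrow> X\<close>: an extension of \<open>Q\<close> by an extension of \<open>R\<close> by \<open>S\<close> can be
  regrouped.
\<close>

lemma extension_assoc_left:
  assumes "extension S Y R" "extension Y X Q"
  obtains W where "extension S X W" "extension R W Q"
proof -
  obtain f f' f'' where t: "exact_tri S Y R f f' f''" using assms(1) unfolding extension_def by blast
  obtain g g' g'' where t2: "exact_tri Y X Q g g' g''" using assms(2) unfolding extension_def by blast
  note f = exact_triD(2)[OF t] and g = exact_triD(2)[OF t2]
  have gf: "g \<cdot> f \<in> homs C S X" using cmp_homs[OF f g] .
  obtain h' h'' where t3: "(g \<cdot> f, h', h'') \<in> tri C" using TR1c homsD[OF gf] by blast
  note t3' = tri_exact_tri[OF t3]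
  obtain u v where uv: "u \<in> homs C (tgt C f') (tgt C h')" "v \<in> homs C (tgt C h') (tgt C g')"
    "(u, v, sig_arr C f' \<cdot> g'') \<in> tri C"
    using TR4[OF f g exact_triD(1)[OF t] exact_triD(1)[OF t2] t3] by blast
  then have "exact_tri R (tgt C h') Q u v (sig_arr C f' \<cdot> g'')"
    using tri_exact_tri[of u v "sig_arr C f' \<cdot> g''"] homsD[OF exact_triD(3)[OF t]]
      homsD[OF exact_triD(3)[OF t2]] homsD[OF uv(1)] homsD[OF uv(2)] by simp
  moreover have "exact_tri S X (tgt C h') (g \<cdot> f) h' h''" using t3' homsD[OF gf] by simp
  ultimately show ?thesis using that unfolding extension_def by meson
qed

text \<open>
  Rotating both triangles turns the fibre \<open>F\<close> into a cone, which \<open>extension_assoc_left\<close> provides up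
  to one translation.
\<close>

lemma extension_assoc_right:
  assumes "extension S X M" "extension R M Q"
  obtains F where "extension F X Q" "extension S F R"
proof -
  have o: "S \<in> obj C" "X \<in> obj C" "M \<in> obj C" "R \<in> obj C" "Q \<in> obj C"
    using extension_objs[OF assms(1)] extension_objs[OF assms(2)] by simp_all
  have "extension X M (sig_obj C S)" "extension M Q (sig_obj C R)"
    using assms extension_rotate_iff[OF o(1,2)] extension_rotate_iff[OF o(4,3)] by simp_all
  then obtain W where W: "extension X Q W" "extension (sig_obj C S) W (sig_obj C R)"
    by (rule extension_assoc_left)
  obtain F where F: "F \<in> obj C" "isomorphic C W (sig_obj C F)"
    using isomorphic_to_sig extension_objs(3)[OF W(1)] by blast
  have "extension X Q (sig_obj C F)"
    using extension_iso[OF W(1) _ _ F(2)] isomorphic_refl o by blast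
  then have 1: "extension F X Q" by (simp only: extension_rotate_iff[OF F(1) o(2)])
  have "extension (sig_obj C S) (sig_obj C F) (sig_obj C R)"
    using extension_iso[OF W(2) _ F(2)] isomorphic_refl o sig_obj_obj by blast
  then have "extension S F R" by (simp only: extension_sig_iff[OF o(1) F(1) o(4)])
  with 1 show ?thesis by (rule that)
qed

section \<open>Triangulated subcategories and torsion pairs\<close>

lemma iso_closed_obj: "iso_closed C (obj C)"
  by (simp add: iso_closed_def)

definition triangulated_subset :: "'a set \<Rightarrow> bool" where
  "triangulated_subset N \<longleftrightarrow> iso_closed C N \<and> (\<forall>X \<in> obj C. sig_obj C X \<in> N \<longleftrightarrow> X \<in> N) \<and>
     (\<forall>X Y Z. extension X Y Z \<longrightarrow> X \<in> N \<longrightarrow> Z \<in> N \<longrightarrow> Y \<in> N) \<and>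
     (\<forall>Z. zero_object C Z \<longrightarrow> Z \<in> N)"

lemma triangulated_subset_obj: "triangulated_subset (obj C)"
  unfolding triangulated_subset_def
  using iso_closed_obj sig_obj_obj extension_objs(2) by (auto simp: zero_object_def)

lemma triangulated_subsetD:
  assumes "triangulated_subset N"
  shows "iso_closed C N" "N \<subseteq> obj C" "X \<in> obj C \<Longrightarrow> sig_obj C X \<in> N \<longleftrightarrow> X \<in> N"
    "extension X Y Z \<Longrightarrow> X \<in> N \<Longrightarrow> Z \<in> N \<Longrightarrow> Y \<in> N" "zero_object C Z \<Longrightarrow> Z \<in> N"
  using assms unfolding triangulated_subset_def iso_closed_def by blast+

lemma triangulated_subset_cone:
  assumes "triangulated_subset N" "extension X Y Z" "X \<in> N" "Y \<in> N"
  shows "Z \<in> N"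
proof -
  note o = extension_objs[OF assms(2)]
  have "extension Y Z (sig_obj C X)" using assms(2) extension_rotate_iff[OF o(1,2)] by simp
  moreover have "sig_obj C X \<in> N" using triangulated_subsetD(3)[OF assms(1) o(1)] assms(3) by simp
  ultimately show ?thesis using triangulated_subsetD(4)[OF assms(1)] assms(4) by blast
qed

lemma triangulated_subset_fibre:
  assumes "triangulated_subset N" "extension X Y Z" "Y \<in> N" "Z \<in> N"
  shows "X \<in> N"
proof -
  note o = extension_objs[OF assms(2)]
  have "extension Y Z (sig_obj C X)" using assms(2) extension_rotate_iff[OF o(1,2)] by simp
  then have "sig_obj C X \<in> N" using triangulated_subset_cone[OF assms(1)] assms(3,4) by blast
  then show ?thesis using triangulated_subsetD(3)[OF assms(1) o(1)] by simp
qed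

lemma shift_triangulated_subset:
  assumes "triangulated_subset N"
  shows "shift C n N = N"
proof (induction n rule: int_induct[of _ 0])
  have m: "shift C (- 1) N = N"
    using triangulated_subsetD(2,3)[OF assms] unfolding shift_minus_one by blast
  note c = triangulated_subsetD(1)[OF assms]
  {
    case base
    show ?case using shift_zero[OF c] .
  next
    case (step1 i)
    then show ?case using shift_succ[OF c, of i] shift_one_minus_one[OF c] m by simp
  next
    case (step2 i)
    then show ?case using shift_pred[OF c, of i] m by simp
  }
qed

text \<open>
  The pair \<open>(V\<^sub>\<le>\<^sub>0, V\<^sub>\<ge>\<^sub>1)\<close> of a t-structure on the subcategory \<open>N\<close>. Starting the second part at \<open>1\<close>
  makes the pair an orthogonal one and puts the third term of the truncation triangle into it.
\<close>

definition torsion_pair :: "'a set \<Rightarrow> 'a set \<Rightarrow> 'a set \<Rightarrow> bool" where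
  "torsion_pair N A B \<longleftrightarrow> iso_closed C A \<and> iso_closed C B \<and> A \<subseteq> N \<and> B \<subseteq> N \<and>
     (\<forall>X \<in> A. sig_obj C X \<in> A) \<and> (\<forall>X \<in> A. \<forall>Y \<in> B. hom_zero X Y) \<and>
     (\<forall>Z \<in> N. \<exists>X \<in> A. \<exists>Y \<in> B. extension X Z Y)"

lemma torsion_pairD:
  assumes "torsion_pair N A B"
  shows "iso_closed C A" "iso_closed C B" "A \<subseteq> N" "B \<subseteq> N" "X \<in> A \<Longrightarrow> sig_obj C X \<in> A"
    "X \<in> A \<Longrightarrow> Y \<in> B \<Longrightarrow> hom_zero X Y"
    "A \<subseteq> obj C" "B \<subseteq> obj C"
  using assms unfolding torsion_pair_def iso_closed_def by blast+

lemma torsion_pair_exact_tri: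
  assumes "torsion_pair N A B" "Z \<in> N"
  obtains X Y f g h where "X \<in> A" "Y \<in> B" "exact_tri X Z Y f g h"
proof -
  have "\<exists>X\<in>A. \<exists>Y\<in>B. extension X Z Y" using assms unfolding torsion_pair_def by blast
  then show ?thesis using that unfolding extension_def by blast
qed

lemma torsion_pair_coreflection:
  assumes P: "torsion_pair N A B" and t: "exact_tri X Z Y f g h" and "X \<in> A" "Y \<in> B"
  shows "coreflection C A Z f"
  unfolding coreflection_def
proof (intro conjI ballI)
  note f = exact_triD(2)[OF t]
  have s: "src C f = X" using homsD[OF f] by simp
  show "f \<in> homs C (src C f) Z" using f s by simp
  show "src C f \<in> A" using s \<open>X \<in> A\<close> by simp
  fix W u assume W: "W \<in> A" and u: "u \<in> homs C W Z"
  have "g \<cdot> u = zero_arr C W Y"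
    using hom_zeroD[OF torsion_pairD(6)[OF P W \<open>Y \<in> B\<close>] cmp_homs[OF u exact_triD(3)[OF t]]] .
  then obtain w where w: "w \<in> homs C W X" "u = f \<cdot> w" using exact_tri_covariant[OF t u] by blast
  have hz: "hom_zero (sig_obj C W) Y" using torsion_pairD(5,6)[OF P] W \<open>Y \<in> B\<close> by blast
  have "v = w" if "v \<in> homs C W X" "f \<cdot> v = u" for v
    using exact_tri_mono[OF t hz that(1) w(1)] that(2) w(2) by simp
  then show "\<exists>!v. v \<in> homs C W (src C f) \<and> f \<cdot> v = u" using w s by blast
qed

lemma torsion_pair_reflection:
  assumes P: "torsion_pair N A B" and t: "exact_tri X Z Y f g h" and "X \<in> A" "Y \<in> B"
  shows "reflection C B Z g"
  unfolding reflection_def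
proof (intro conjI ballI)
  note g = exact_triD(3)[OF t]
  have s: "tgt C g = Y" using homsD[OF g] by simp
  show "g \<in> homs C Z (tgt C g)" using g s by simp
  show "tgt C g \<in> B" using s \<open>Y \<in> B\<close> by simp
  fix W u assume W: "W \<in> B" and u: "u \<in> homs C Z W"
  have "u \<cdot> f = zero_arr C X W"
    using hom_zeroD[OF torsion_pairD(6)[OF P \<open>X \<in> A\<close> W] cmp_homs[OF exact_triD(2)[OF t] u]] .
  then obtain w where w: "w \<in> homs C Y W" "u = w \<cdot> g" using exact_tri_contravariant[OF t u] by blast
  have hz: "hom_zero (sig_obj C X) W" using torsion_pairD(5,6)[OF P] W \<open>X \<in> A\<close> by blast
  have "v = w" if "v \<in> homs C Y W" "v \<cdot> g = u" for v
    using exact_tri_epi[OF t hz that(1) w(1)] that(2) w(2) by simp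
  then show "\<exists>!v. v \<in> homs C (tgt C g) W \<and> v \<cdot> g = u" using w s by blast
qed

text \<open>
  If \<open>X\<close> is left orthogonal to \<open>B\<close>, the arrow \<open>f\<close> in its truncation triangle \<open>P \<rightarrow> X \<rightarrow> Q\<close> has a section
  \<open>s\<close>, and \<open>f \<cdot> -\<close> is injective on \<open>Hom(P, P)\<close> since \<open>\<Sigma> P \<in> A\<close>; hence \<open>s\<close> is inverse to \<open>f\<close>.
\<close>

lemma torsion_pair_left_iff:
  assumes P: "torsion_pair N A B" and X: "X \<in> N" and N: "N \<subseteq> obj C"
  shows "X \<in> A \<longleftrightarrow> (\<forall>Y \<in> B. hom_zero X Y)"
proof
  assume "X \<in> A"
  then show "\<forall>Y \<in> B. hom_zero X Y" using torsion_pairD(6)[OF P] by blast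
next
  assume *: "\<forall>Y \<in> B. hom_zero X Y"
  obtain P Q f g h where PQ: "P \<in> A" "Q \<in> B" and t: "exact_tri P X Q f g h"
    using torsion_pair_exact_tri[OF P X] .
  have Xo: "X \<in> obj C" using X N by blast
  note f = exact_triD(2)[OF t] and i = idt_homs[OF Xo]
  have "g \<cdot> idt C X = zero_arr C X Q"
    using hom_zeroD[of X Q] * PQ cmp_idt[OF exact_triD(3)[OF t]] exact_triD(3)[OF t] by simp
  then obtain s where s: "s \<in> homs C X P" "idt C X = f \<cdot> s"
    using exact_tri_covariant[OF t i] by blast
  have hz: "hom_zero (sig_obj C P) Q" using torsion_pairD(5,6)[OF P] PQ by blast
  have "f \<cdot> (s \<cdot> f) = f \<cdot> idt C P"
    using cmp_assoc[OF f s(1) f] s(2) idt_cmp[OF f] cmp_idt[OF f] by simp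
  then have "s \<cdot> f = idt C P"
    using exact_tri_mono[OF t hz cmp_homs[OF f s(1)] idt_homs[OF exact_triD(5)[OF t]]] by simp
  then have "isomorphic C P X" using s f unfolding isomorphic_iff by metis
  then show "X \<in> A" using iso_closedD[OF torsion_pairD(1)[OF P] PQ(1)] by blast
qed

lemma torsion_pair_right_iff:
  assumes P: "torsion_pair N A B" and Y: "Y \<in> N" and N: "N \<subseteq> obj C"
  shows "Y \<in> B \<longleftrightarrow> (\<forall>X \<in> A. hom_zero X Y)"
proof
  assume "Y \<in> B"
  then show "\<forall>X \<in> A. hom_zero X Y" using torsion_pairD(6)[OF P] by blast
next
  assume *: "\<forall>X \<in> A. hom_zero X Y"
  obtain P Q f g h where PQ: "P \<in> A" "Q \<in> B" and t: "exact_tri P Y Q f g h"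
    using torsion_pair_exact_tri[OF P Y] .
  have Yo: "Y \<in> obj C" using Y N by blast
  note g = exact_triD(3)[OF t] and i = idt_homs[OF Yo]
  have "idt C Y \<cdot> f = zero_arr C P Y"
    using hom_zeroD[of P Y] * PQ idt_cmp[OF exact_triD(2)[OF t]] exact_triD(2)[OF t] by simp
  then obtain s where s: "s \<in> homs C Q Y" "idt C Y = s \<cdot> g"
    using exact_tri_contravariant[OF t i] by blast
  have hz: "hom_zero (sig_obj C P) Q" using torsion_pairD(5,6)[OF P] PQ by blast
  have "(g \<cdot> s) \<cdot> g = idt C Q \<cdot> g"
    using cmp_assoc[OF g s(1) g] s(2) idt_cmp[OF g] cmp_idt[OF g] by simp
  then have "g \<cdot> s = idt C Q"
    using exact_tri_epi[OF t hz cmp_homs[OF s(1) g] idt_homs[OF exact_triD(7)[OF t]]] by simp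
  then have "isomorphic C Q Y" using s g unfolding isomorphic_iff by metis
  then show "Y \<in> B" using iso_closedD[OF torsion_pairD(2)[OF P] PQ(2)] by blast
qed

lemma torsion_pair_extension_left:
  assumes N: "triangulated_subset N" and P: "torsion_pair N A B"
    and e: "extension X Y Z" and "X \<in> A" "Z \<in> A"
  shows "Y \<in> A"
proof -
  have "Y \<in> N" using triangulated_subsetD(4)[OF N e] torsion_pairD(3)[OF P] assms(4,5) by blast
  moreover have "hom_zero Y W" if "W \<in> B" for W
    using hom_zero_extension_left[OF e] torsion_pairD(6)[OF P _ that] assms(4,5) by blast
  ultimately show ?thesis
    using torsion_pair_left_iff[OF P _ triangulated_subsetD(2)[OF N]] by blast
qed

lemma torsion_pair_extension_right:
  assumes N: "triangulated_subset N" and P: "torsion_pair N A B"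
    and e: "extension X Y Z" and "X \<in> B" "Z \<in> B"
  shows "Y \<in> B"
proof -
  have "Y \<in> N" using triangulated_subsetD(4)[OF N e] torsion_pairD(4)[OF P] assms(4,5) by blast
  moreover have "hom_zero W Y" if "W \<in> A" for W
    using hom_zero_extension_right[OF e] torsion_pairD(6)[OF P that] assms(4,5) by blast
  ultimately show ?thesis
    using torsion_pair_right_iff[OF P _ triangulated_subsetD(2)[OF N]] by blast
qed

lemma torsion_pair_zero:
  assumes N: "triangulated_subset N" and P: "torsion_pair N A B" and Z: "zero_object C Z"
  shows "Z \<in> A" "Z \<in> B"
proof -
  have ZN: "Z \<in> N" using triangulated_subsetD(5)[OF N Z] .
  note No = triangulated_subsetD(2)[OF N]
  show "Z \<in> A" using torsion_pair_left_iff[OF P ZN No] zero_object_homs(2)[OF Z] torsion_pairD(8)[OF P]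
    by blast
  show "Z \<in> B" using torsion_pair_right_iff[OF P ZN No] zero_object_homs(1)[OF Z] torsion_pairD(7)[OF P]
    by blast
qed

lemma torsion_pair_subset_iff:
  assumes N: "N \<subseteq> obj C" and P: "torsion_pair N A B" and P': "torsion_pair N A' B'"
  shows "A \<subseteq> A' \<longleftrightarrow> B' \<subseteq> B"
proof
  assume s: "A \<subseteq> A'"
  show "B' \<subseteq> B"
  proof
    fix Y assume Y: "Y \<in> B'"
    then have "Y \<in> N" using torsion_pairD(4)[OF P'] by blast
    then show "Y \<in> B" using torsion_pair_right_iff[OF P _ N] torsion_pairD(6)[OF P' _ Y] s by blast
  qed
next
  assume s: "B' \<subseteq> B"
  show "A \<subseteq> A'"
  proof
    fix X assume X: "X \<in> A"
    then have "X \<in> N" using torsion_pairD(3)[OF P] by blast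
    then show "X \<in> A'" using torsion_pair_left_iff[OF P' _ N] torsion_pairD(6)[OF P X] s by blast
  qed
qed

text \<open>
  Truncation triangles of \<open>Z\<close> for the shifted pair are desuspensions of those of \<open>\<Sigma> Z\<close>.
\<close>

lemma torsion_pair_shift_minus_one:
  assumes N: "triangulated_subset N" and P: "torsion_pair N A B"
  shows "torsion_pair N (shift C (- 1) A) (shift C (- 1) B)"
  unfolding torsion_pair_def
proof (intro conjI ballI)
  show "iso_closed C (shift C (- 1) A)" using iso_closed_shift[OF torsion_pairD(1)[OF P]] .
  show "iso_closed C (shift C (- 1) B)" using iso_closed_shift[OF torsion_pairD(2)[OF P]] .
  show "shift C (- 1) A \<subseteq> N" using shift_mono[OF torsion_pairD(3)[OF P]] shift_triangulated_subset[OF N]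
    by blast
  show "shift C (- 1) B \<subseteq> N" using shift_mono[OF torsion_pairD(4)[OF P]] shift_triangulated_subset[OF N]
    by blast
  show "sig_obj C X \<in> shift C (- 1) A" if "X \<in> shift C (- 1) A" for X
    using that torsion_pairD(5)[OF P] sig_obj_obj unfolding shift_minus_one by blast
  show "hom_zero X Y" if "X \<in> shift C (- 1) A" "Y \<in> shift C (- 1) B" for X Y
    using that torsion_pairD(6)[OF P] hom_zero_sig_iff[of X Y] unfolding shift_minus_one by blast
  fix Z assume Z: "Z \<in> N"
  have Zo: "Z \<in> obj C" using Z triangulated_subsetD(2)[OF N] by blast
  then have "sig_obj C Z \<in> N" using triangulated_subsetD(3)[OF N] Z by blast
  then obtain X Y f g h where XY: "X \<in> A" "Y \<in> B" "exact_tri X (sig_obj C Z) Y f g h"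
    using torsion_pair_exact_tri[OF P] by blast
  then have e: "extension X (sig_obj C Z) Y" unfolding extension_def by blast
  obtain X' where X': "X' \<in> obj C" "isomorphic C X (sig_obj C X')"
    using isomorphic_to_sig extension_objs(1)[OF e] by blast
  obtain Y' where Y': "Y' \<in> obj C" "isomorphic C Y (sig_obj C Y')"
    using isomorphic_to_sig extension_objs(3)[OF e] by blast
  have "extension (sig_obj C X') (sig_obj C Z) (sig_obj C Y')"
    using extension_iso[OF e X'(2) isomorphic_refl[OF sig_obj_obj[OF Zo]] Y'(2)] .
  then have "extension X' Z Y'" using extension_sig_iff[OF X'(1) Zo Y'(1)] by simp
  moreover have "sig_obj C X' \<in> A" "sig_obj C Y' \<in> B"
    using iso_closedD[OF torsion_pairD(1)[OF P] XY(1) X'(2)]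
      iso_closedD[OF torsion_pairD(2)[OF P] XY(2) Y'(2)] .
  ultimately show "\<exists>X\<in>shift C (- 1) A. \<exists>Y\<in>shift C (- 1) B. extension X Z Y"
    using X'(1) Y'(1) unfolding shift_minus_one by blast
qed

lemma torsion_pair_shift_one:
  assumes N: "triangulated_subset N" and P: "torsion_pair N A B"
  shows "torsion_pair N (shift C 1 A) (shift C 1 B)"
  unfolding torsion_pair_def
proof (intro conjI ballI)
  have o: "X \<in> obj C" if "X \<in> A \<or> X \<in> B" for X using that torsion_pairD(7,8)[OF P] by blast
  show "iso_closed C (shift C 1 A)" using iso_closed_shift[OF torsion_pairD(1)[OF P]] .
  show "iso_closed C (shift C 1 B)" using iso_closed_shift[OF torsion_pairD(2)[OF P]] .
  show "shift C 1 A \<subseteq> N" using shift_mono[OF torsion_pairD(3)[OF P]] shift_triangulated_subset[OF N]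
    by blast
  show "shift C 1 B \<subseteq> N" using shift_mono[OF torsion_pairD(4)[OF P]] shift_triangulated_subset[OF N]
    by blast
  show "sig_obj C X \<in> shift C 1 A" if X: "X \<in> shift C 1 A" for X
  proof -
    obtain Y where Y: "Y \<in> A" "isomorphic C (sig_obj C Y) X" using X unfolding shift_one by blast
    note XY = isomorphic_objs[OF Y(2)]
    have "isomorphic C (sig_obj C (sig_obj C Y)) (sig_obj C X)"
      using isomorphic_sig_iff[of "sig_obj C Y" X] XY Y(2) by simp
    then show ?thesis
      using torsion_pairD(5)[OF P Y(1)] sig_obj_obj XY unfolding shift_one by blast
  qed
  show "hom_zero X Y" if XY: "X \<in> shift C 1 A" "Y \<in> shift C 1 B" for X Y
  proof -
    obtain X' where X': "X' \<in> A" "isomorphic C (sig_obj C X') X" using XY(1) unfolding shift_one by blast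
    obtain Y' where Y': "Y' \<in> B" "isomorphic C (sig_obj C Y') Y" using XY(2) unfolding shift_one by blast
    have "hom_zero (sig_obj C X') (sig_obj C Y')"
      using hom_zero_sig_iff[of X' Y'] torsion_pairD(6)[OF P X'(1) Y'(1)] o X'(1) Y'(1) by blast
    then show ?thesis using hom_zero_iso X'(2) Y'(2) by blast
  qed
  fix Z assume Z: "Z \<in> N"
  have Zo: "Z \<in> obj C" using Z triangulated_subsetD(2)[OF N] by blast
  obtain Z' where Z': "Z' \<in> obj C" "isomorphic C Z (sig_obj C Z')" using isomorphic_to_sig[OF Zo] .
  have "Z' \<in> N"
    using iso_closedD[OF triangulated_subsetD(1)[OF N] Z Z'(2)] triangulated_subsetD(3)[OF N Z'(1)] by simp
  then obtain X Y f g h where XY: "X \<in> A" "Y \<in> B" "exact_tri X Z' Y f g h"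
    using torsion_pair_exact_tri[OF P] by blast
  then have e: "extension X Z' Y" unfolding extension_def by blast
  note eo = extension_objs[OF e]
  have "extension (sig_obj C X) (sig_obj C Z') (sig_obj C Y)" using extension_sig_iff[OF eo] e by simp
  then have "extension (sig_obj C X) Z (sig_obj C Y)"
    using extension_iso[OF _ isomorphic_refl[OF sig_obj_obj[OF eo(1)]] isomorphic_sym[OF Z'(2)]
      isomorphic_refl[OF sig_obj_obj[OF eo(3)]]] by simp
  moreover have "sig_obj C X \<in> shift C 1 A" "sig_obj C Y \<in> shift C 1 B"
    using XY(1,2) eo isomorphic_refl sig_obj_obj unfolding shift_one by blast+
  ultimately show "\<exists>X\<in>shift C 1 A. \<exists>Y\<in>shift C 1 B. extension X Z Y" by blast
qed

lemma torsion_pair_shift: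
  assumes N: "triangulated_subset N" and P: "torsion_pair N A B"
  shows "torsion_pair N (shift C n A) (shift C n B)"
proof (induction n rule: int_induct[of _ 0])
  note A = torsion_pairD(1)[OF P] and B = torsion_pairD(2)[OF P]
  {
    case base
    show ?case using P shift_zero[OF A] shift_zero[OF B] by simp
  next
    case (step1 i)
    then show ?case
      using torsion_pair_shift_one[OF N step1(2)] shift_succ[OF A, of i] shift_succ[OF B, of i] by simp
  next
    case (step2 i)
    then show ?case
      using torsion_pair_shift_minus_one[OF N step2(2)] shift_pred[OF A, of i] shift_pred[OF B, of i]
      by simp
  }
qed

section \<open>t-structures on a triangulated subcategory\<close>

definition t_structure_on :: "'a set \<Rightarrow> 'a tpair \<Rightarrow> bool" where
  "t_structure_on N V \<longleftrightarrow> iso_closed C (fst V) \<and> iso_closed C (snd V) \<and>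
     torsion_pair N (fst V) (shift C (- 1) (snd V))"

lemma t_le_succ_iff:
  assumes "iso_closed C (fst V)" "X \<in> obj C"
  shows "sig_obj C X \<in> t_le C V n \<longleftrightarrow> X \<in> t_le C V (n + 1)"
  using shift_pred[OF assms(1), of "- n"] assms(2) by (simp add: t_le_def shift_minus_one)

lemma t_ge_succ_iff:
  assumes "iso_closed C (snd V)" "X \<in> obj C"
  shows "sig_obj C X \<in> t_ge C V n \<longleftrightarrow> X \<in> t_ge C V (n + 1)"
  using shift_pred[OF assms(1), of "- n"] assms(2) by (simp add: t_ge_def shift_minus_one)

context
  fixes N V
  assumes N: "triangulated_subset N" and V: "t_structure_on N V"
begin

lemma t_on_iso_closed: "iso_closed C (fst V)" "iso_closed C (snd V)"
  using V unfolding t_structure_on_def by auto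

lemma t_on_le_zero: "t_le C V 0 = fst V"
  using shift_zero[OF t_on_iso_closed(1)] by (simp add: t_le_def)

lemma t_on_ge_zero: "t_ge C V 0 = snd V"
  using shift_zero[OF t_on_iso_closed(2)] by (simp add: t_ge_def)

lemma t_on_torsion_pair: "torsion_pair N (t_le C V n) (t_ge C V (n + 1))"
proof -
  have "torsion_pair N (fst V) (shift C (- 1) (snd V))" using V unfolding t_structure_on_def by blast
  from torsion_pair_shift[OF N this, of "- n"] show ?thesis
    using shift_shift[OF t_on_iso_closed(2), of "- n" "- 1"] by (simp add: t_le_def t_ge_def)
qed

lemma t_on_torsion_pair': "torsion_pair N (t_le C V (n - 1)) (t_ge C V n)"
  using t_on_torsion_pair[of "n - 1"] by simp

lemma t_on_le_iso_closed: "iso_closed C (t_le C V n)"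
  using torsion_pairD(1)[OF t_on_torsion_pair] .

lemma t_on_ge_iso_closed: "iso_closed C (t_ge C V n)"
  using torsion_pairD(2)[OF t_on_torsion_pair'] .

lemma t_on_le_subset: "t_le C V n \<subseteq> N"
  using torsion_pairD(3)[OF t_on_torsion_pair] .

lemma t_on_ge_subset: "t_ge C V n \<subseteq> N"
  using torsion_pairD(4)[OF t_on_torsion_pair'] .

lemma t_on_subset: "fst V \<subseteq> N" "snd V \<subseteq> N"
  using t_on_le_subset[of 0] t_on_ge_subset[of 0] t_on_le_zero t_on_ge_zero by auto

lemma t_on_le_sig: "X \<in> obj C \<Longrightarrow> sig_obj C X \<in> t_le C V n \<longleftrightarrow> X \<in> t_le C V (n + 1)"
  using t_le_succ_iff[OF t_on_iso_closed(1)] .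

lemma t_on_ge_sig: "X \<in> obj C \<Longrightarrow> sig_obj C X \<in> t_ge C V n \<longleftrightarrow> X \<in> t_ge C V (n + 1)"
  using t_ge_succ_iff[OF t_on_iso_closed(2)] .

lemma t_on_le_succ: "t_le C V n \<subseteq> t_le C V (n + 1)"
proof
  fix X assume X: "X \<in> t_le C V n"
  then have "X \<in> obj C" using torsion_pairD(7)[OF t_on_torsion_pair] by blast
  then show "X \<in> t_le C V (n + 1)"
    using t_on_le_sig[of X n] torsion_pairD(5)[OF t_on_torsion_pair X] by simp
qed

lemma t_on_le_mono: "m \<le> n \<Longrightarrow> t_le C V m \<subseteq> t_le C V n"
proof (induction n rule: int_ge_induct)
  case (step i)
  then show ?case using t_on_le_succ[of i] by blast
qed simp

lemma t_on_ge_mono: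
  assumes "m \<le> n"
  shows "t_ge C V n \<subseteq> t_ge C V m"
  using torsion_pair_subset_iff[OF triangulated_subsetD(2)[OF N] t_on_torsion_pair'[of m]
      t_on_torsion_pair'[of n]] t_on_le_mono[of "m - 1" "n - 1"] assms by simp

lemma t_on_le_extension:
  "\<lbrakk>extension X Y Z; X \<in> t_le C V n; Z \<in> t_le C V n\<rbrakk> \<Longrightarrow> Y \<in> t_le C V n"
  using torsion_pair_extension_left[OF N t_on_torsion_pair] .

lemma t_on_ge_extension:
  "\<lbrakk>extension X Y Z; X \<in> t_ge C V n; Z \<in> t_ge C V n\<rbrakk> \<Longrightarrow> Y \<in> t_ge C V n"
  using torsion_pair_extension_right[OF N t_on_torsion_pair'] .

text \<open>
  Independent bounds are easier to supply than the symmetric ones of the definition.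
\<close>

lemma t_on_bounded_iff: "X \<in> t_bounded C V \<longleftrightarrow> (\<exists>m n. X \<in> t_ge C V m \<and> X \<in> t_le C V n)"
proof
  assume "\<exists>m n. X \<in> t_ge C V m \<and> X \<in> t_le C V n"
  then obtain m n where X: "X \<in> t_ge C V m" "X \<in> t_le C V n" by blast
  define k where "k = nat (max (- m) n)"
  have k: "- int k \<le> m" "n \<le> int k" unfolding k_def by linarith+
  have "X \<in> t_ge C V (- int k)" using t_on_ge_mono[OF k(1)] X(1) by blast
  moreover have "X \<in> t_le C V (int k)" using t_on_le_mono[OF k(2)] X(2) by blast
  ultimately show "X \<in> t_bounded C V" unfolding t_bounded_def t_interval_def by blast
qed (auto simp: t_bounded_def t_interval_def)

lemma t_on_bounded_triangulated: "triangulated_subset (t_bounded C V)"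
  unfolding triangulated_subset_def
proof (intro conjI allI impI ballI)
  have sub: "t_bounded C V \<subseteq> obj C"
    using t_on_le_subset triangulated_subsetD(2)[OF N] t_on_bounded_iff by blast
  have "Y \<in> t_bounded C V" if "X \<in> t_bounded C V" "isomorphic C X Y" for X Y
    using that t_on_bounded_iff[of X] t_on_bounded_iff[of Y]
      iso_closedD[OF t_on_le_iso_closed _ that(2)] iso_closedD[OF t_on_ge_iso_closed _ that(2)]
    by blast
  then show "iso_closed C (t_bounded C V)" using sub unfolding iso_closed_def by blast
  show "sig_obj C X \<in> t_bounded C V \<longleftrightarrow> X \<in> t_bounded C V" if X: "X \<in> obj C" for X
  proof
    assume "sig_obj C X \<in> t_bounded C V"
    then show "X \<in> t_bounded C V"
      using t_on_bounded_iff[of X] t_on_bounded_iff[of "sig_obj C X"] t_on_le_sig[OF X] t_on_ge_sig[OF X]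
      by blast
  next
    assume "X \<in> t_bounded C V"
    then obtain m n where "X \<in> t_ge C V m" "X \<in> t_le C V n" using t_on_bounded_iff[of X] by blast
    then have "sig_obj C X \<in> t_ge C V (m - 1)" "sig_obj C X \<in> t_le C V (n - 1)"
      using t_on_le_sig[OF X, of "n - 1"] t_on_ge_sig[OF X, of "m - 1"] by simp_all
    then show "sig_obj C X \<in> t_bounded C V" using t_on_bounded_iff[of "sig_obj C X"] by blast
  qed
  show "Y \<in> t_bounded C V"
    if e: "extension X Y Z" and X: "X \<in> t_bounded C V" and Z: "Z \<in> t_bounded C V" for X Y Z
  proof -
    obtain m n where m: "X \<in> t_ge C V m" "X \<in> t_le C V n" using X t_on_bounded_iff[of X] by blast
    obtain k l where k: "Z \<in> t_ge C V k" "Z \<in> t_le C V l" using Z t_on_bounded_iff[of Z] by blast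
    have "X \<in> t_ge C V (min m k)" "Z \<in> t_ge C V (min m k)"
      using t_on_ge_mono[of "min m k" m] t_on_ge_mono[of "min m k" k] m k by auto
    then have 1: "Y \<in> t_ge C V (min m k)" using t_on_ge_extension[OF e] by blast
    have "X \<in> t_le C V (max n l)" "Z \<in> t_le C V (max n l)"
      using t_on_le_mono[of n "max n l"] t_on_le_mono[of l "max n l"] m k by auto
    then have "Y \<in> t_le C V (max n l)" using t_on_le_extension[OF e] by blast
    with 1 show ?thesis using t_on_bounded_iff[of Y] by blast
  qed
  show "Z \<in> t_bounded C V" if "zero_object C Z" for Z
    using torsion_pair_zero[OF N t_on_torsion_pair[of 0] that]  t_on_bounded_iff[of Z] by blast
qed

lemma t_on_bounded_subset: "t_bounded C V \<subseteq> N"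
  using t_on_le_subset t_on_bounded_iff by blast

lemma t_restrict_le: "t_le C (t_restrict C V) n = t_bounded C V \<inter> t_le C V n"
  using shift_Int[OF triangulated_subsetD(1)[OF t_on_bounded_triangulated] t_on_iso_closed(1)]
    shift_triangulated_subset[OF t_on_bounded_triangulated] by (simp add: t_restrict_def t_le_def)

lemma t_restrict_ge: "t_ge C (t_restrict C V) n = t_bounded C V \<inter> t_ge C V n"
  using shift_Int[OF triangulated_subsetD(1)[OF t_on_bounded_triangulated] t_on_iso_closed(2)]
    shift_triangulated_subset[OF t_on_bounded_triangulated] by (simp add: t_restrict_def t_ge_def)

text \<open>
  Both terms of a truncation triangle \<open>X \<rightarrow> Z \<rightarrow> Y\<close> of a bounded object \<open>Z\<close> are bounded: \<open>\<Sigma> X\<close> is an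
  extension of \<open>\<Sigma> Z\<close> by \<open>Y\<close>, which bounds \<open>X\<close> from below, and \<open>Y\<close> is a cone.
\<close>

lemma t_restrict_t_structure_on: "t_structure_on (t_bounded C V) (t_restrict C V)"
proof -
  let ?B = "t_bounded C V"
  note B = t_on_bounded_triangulated
  note c = triangulated_subsetD(1)[OF B]
  have 1: "iso_closed C (?B \<inter> fst V)" using iso_closed_Int[OF c t_on_iso_closed(1)] .
  have 2: "iso_closed C (?B \<inter> snd V)" using iso_closed_Int[OF c t_on_iso_closed(2)] .
  have s: "shift C (- 1) (?B \<inter> snd V) = ?B \<inter> t_ge C V 1" using t_restrict_ge[of 1]
    by (simp add: t_restrict_def t_ge_def)
  note P = t_on_torsion_pair[of 0, unfolded t_on_le_zero, simplified]
  have "torsion_pair ?B (?B \<inter> fst V) (?B \<inter> t_ge C V 1)"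
    unfolding torsion_pair_def
  proof (intro conjI ballI)
    show "iso_closed C (?B \<inter> fst V)" using 1 .
    show "iso_closed C (?B \<inter> t_ge C V 1)" using iso_closed_Int[OF c t_on_ge_iso_closed] .
    show "sig_obj C X \<in> ?B \<inter> fst V" if "X \<in> ?B \<inter> fst V" for X
      using that triangulated_subsetD(2)[OF B] triangulated_subsetD(3)[OF B, of X]
        torsion_pairD(5)[OF P, of X] by blast
    show "hom_zero X Y" if "X \<in> ?B \<inter> fst V" "Y \<in> ?B \<inter> t_ge C V 1" for X Y
      using that torsion_pairD(6)[OF P] by blast
    fix Z assume Z: "Z \<in> ?B"
    have "Z \<in> N" using Z t_on_bounded_subset by blast
    then obtain X Y f g h where XY: "X \<in> fst V" "Y \<in> t_ge C V 1" "exact_tri X Z Y f g h"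
      using torsion_pair_exact_tri[OF P] by blast
    then have e: "extension X Z Y" unfolding extension_def by blast
    note o = extension_objs[OF e]
    obtain m where m: "Z \<in> t_ge C V m" using Z t_on_bounded_iff[of Z] by blast
    let ?k = "min 1 (m - 1)"
    have "sig_obj C Z \<in> t_ge C V (m - 1)" using t_on_ge_sig[OF o(2), of "m - 1"] m by simp
    then have "sig_obj C Z \<in> t_ge C V ?k" using t_on_ge_mono[of ?k "m - 1", OF min.cobounded2] by blast
    moreover have "Y \<in> t_ge C V ?k" using t_on_ge_mono[of ?k 1, OF min.cobounded1] XY(2) by blast
    moreover have "extension Y (sig_obj C X) (sig_obj C Z)"
      using e extension_rotate_iff[OF o(1,2)] extension_rotate_iff[OF o(2,3)] by simp
    ultimately have "sig_obj C X \<in> t_ge C V ?k" using t_on_ge_extension by blast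
    then have "X \<in> t_ge C V (?k + 1)" using t_on_ge_sig[OF o(1)] by blast
    moreover have "X \<in> t_le C V 0" using XY(1) t_on_le_zero by simp
    ultimately have X: "X \<in> ?B" using t_on_bounded_iff[of X] by blast
    then have "Y \<in> ?B" using triangulated_subset_cone[OF B e] Z by blast
    with X XY e show "\<exists>X\<in>?B \<inter> fst V. \<exists>Y\<in>?B \<inter> t_ge C V 1. extension X Z Y" by blast
  qed auto
  then show ?thesis using 1 2 s unfolding t_structure_on_def by (simp add: t_restrict_def)
qed

end

lemma t_le_subset_shift_iff:
  assumes "iso_closed C (fst V)" "iso_closed C (fst W)"
  shows "t_le C V (m + k) \<subseteq> t_le C W (n + k) \<longleftrightarrow> t_le C V m \<subseteq> t_le C W n"
proof -
  have "t_le C V (m + k) = shift C (- k) (t_le C V m)"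
    using shift_shift[OF assms(1), of "- k" "- m"] by (simp add: t_le_def algebra_simps)
  moreover have "t_le C W (n + k) = shift C (- k) (t_le C W n)"
    using shift_shift[OF assms(2), of "- k" "- n"] by (simp add: t_le_def algebra_simps)
  ultimately show ?thesis
    using shift_subset_iff[of "t_le C V m" "t_le C W n" "- k"] iso_closed_shift assms
    by (simp add: t_le_def)
qed

lemma t_on_le_subset_iff_ge:
  assumes N: "triangulated_subset N" and V: "t_structure_on N V" and W: "t_structure_on N W"
  shows "t_le C V m \<subseteq> t_le C W n \<longleftrightarrow> t_ge C W (n + 1) \<subseteq> t_ge C V (m + 1)"
  using torsion_pair_subset_iff[OF triangulated_subsetD(2)[OF N] t_on_torsion_pair[OF N V]
      t_on_torsion_pair[OF N W]] .

lemma t_on_eqI: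
  assumes N: "triangulated_subset N" and V: "t_structure_on N V" and W: "t_structure_on N W"
    and e: "fst V = fst W"
  shows "V = W"
proof -
  have "t_le C V (- 1) = t_le C W (- 1)" using e by (simp add: t_le_def)
  then have "t_ge C V 0 = t_ge C W 0"
    using t_on_le_subset_iff_ge[OF N V W, of "- 1" "- 1"] t_on_le_subset_iff_ge[OF N W V, of "- 1" "- 1"]
    by simp
  then have "snd V = snd W" using t_on_ge_zero[OF N V] t_on_ge_zero[OF N W] by simp
  with e show ?thesis by (simp add: prod_eq_iff)
qed

section \<open>Finite distance\<close>

definition finite_distance :: "'a tpair \<Rightarrow> 'a tpair \<Rightarrow> bool" where
  "finite_distance U V \<longleftrightarrow> (\<exists>a b. t_le C U a \<subseteq> fst V \<and> fst V \<subseteq> t_le C U b)"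

lemma t_dist_finite_iff:
  assumes N: "triangulated_subset N" and U: "t_structure_on N U" and V: "t_structure_on N V"
  shows "t_dist C U V < \<infinity> \<longleftrightarrow> finite_distance U V"
proof -
  let ?D = "{enat d | d. \<exists>m::int. t_le C V m \<subseteq> fst U \<and> fst U \<subseteq> t_le C V (m + int d)}"
  have "t_dist C U V < \<infinity> \<longleftrightarrow> ?D \<noteq> {}"
  proof
    assume l: "t_dist C U V < \<infinity>"
    show "?D \<noteq> {}"
    proof
      assume e: "?D = {}"
      show False using l unfolding t_dist_def e by (simp add: Inf_enat_def)
    qed
  next
    assume "?D \<noteq> {}"
    then obtain d where "enat d \<in> ?D" by blast
    then have "t_dist C U V \<le> enat d" unfolding t_dist_def by (rule Inf_lower)
    then show "t_dist C U V < \<infinity>" by (rule le_less_trans) simp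
  qed
  also have "\<dots> \<longleftrightarrow> finite_distance U V"
  proof
    assume "?D \<noteq> {}"
    then obtain d m where *: "t_le C V m \<subseteq> fst U" "fst U \<subseteq> t_le C V (m + int d)" by blast
    have "t_le C V 0 \<subseteq> t_le C U (- m)"
      using t_le_subset_shift_iff[OF t_on_iso_closed(1)[OF N V] t_on_iso_closed(1)[OF N U], of m "- m" 0]
        * t_on_le_zero[OF N U] by simp
    moreover have "t_le C U (- (m + int d)) \<subseteq> t_le C V 0"
      using t_le_subset_shift_iff[OF t_on_iso_closed(1)[OF N U] t_on_iso_closed(1)[OF N V],
          of 0 "- (m + int d)" "m + int d"] * t_on_le_zero[OF N U] by simp
    ultimately show "finite_distance U V" unfolding finite_distance_def using t_on_le_zero[OF N V] by auto
  next
    assume "finite_distance U V"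
    then obtain a b where *: "t_le C U a \<subseteq> t_le C V 0" "t_le C V 0 \<subseteq> t_le C U b"
      unfolding finite_distance_def using t_on_le_zero[OF N V] by auto
    let ?d = "nat (b - a)"
    have "t_le C V (- b) \<subseteq> t_le C U 0"
      using t_le_subset_shift_iff[OF t_on_iso_closed(1)[OF N V] t_on_iso_closed(1)[OF N U], of 0 "- b" b]
        * by simp
    moreover have "t_le C U 0 \<subseteq> t_le C V (- a)"
      using t_le_subset_shift_iff[OF t_on_iso_closed(1)[OF N U] t_on_iso_closed(1)[OF N V], of a "- a" 0]
        * by simp
    moreover have "t_le C V (- a) \<subseteq> t_le C V (- b + int ?d)"
      using t_on_le_mono[OF N V, of "- a" "- b + int ?d"] by simp
    ultimately have "enat ?d \<in> ?D" unfolding t_on_le_zero[OF N U] by blast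
    then show "?D \<noteq> {}" by blast
  qed
  finally show ?thesis .
qed

text \<open>
  The inclusions for all degrees and both halves of the t-structures; those for the upper halves
  follow by taking orthogonals.
\<close>

lemma finite_distance_levels:
  assumes N: "triangulated_subset N" and U: "t_structure_on N U" and V: "t_structure_on N V"
    and "finite_distance U V"
  obtains a b where "a \<le> b" "\<And>n. t_le C U (n + a) \<subseteq> t_le C V n" "\<And>n. t_le C V n \<subseteq> t_le C U (n + b)"
    "\<And>n. t_ge C V n \<subseteq> t_ge C U (n + a)" "\<And>n. t_ge C U (n + b) \<subseteq> t_ge C V n"
proof -
  obtain a b' where *: "t_le C U a \<subseteq> t_le C V 0" "t_le C V 0 \<subseteq> t_le C U b'"
    using assms(4) unfolding finite_distance_def using t_on_le_zero[OF N V] by auto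
  let ?b = "max a b'"
  have b: "t_le C V 0 \<subseteq> t_le C U ?b" using *(2) t_on_le_mono[OF N U, of b' ?b, OF max.cobounded2] by blast
  have 1: "t_le C U (n + a) \<subseteq> t_le C V n" for n
    using t_le_subset_shift_iff[OF t_on_iso_closed(1)[OF N U] t_on_iso_closed(1)[OF N V], of a n 0] *
    by (simp add: add.commute)
  have 2: "t_le C V n \<subseteq> t_le C U (n + ?b)" for n
    using t_le_subset_shift_iff[OF t_on_iso_closed(1)[OF N V] t_on_iso_closed(1)[OF N U], of 0 n ?b] b
    by (simp add: add.commute)
  have 3: "t_ge C V n \<subseteq> t_ge C U (n + a)" for n
    using t_on_le_subset_iff_ge[OF N U V, of "n - 1 + a" "n - 1"] 1[of "n - 1"] by simp
  have 4: "t_ge C U (n + ?b) \<subseteq> t_ge C V n" for n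
    using t_on_le_subset_iff_ge[OF N V U, of "n - 1" "n - 1 + ?b"] 2[of "n - 1"] by simp
  show ?thesis using that[of a ?b] 1 2 3 4 by simp
qed

lemma finite_distance_bounded_eq:
  assumes N: "triangulated_subset N" and U: "t_structure_on N U" and V: "t_structure_on N V"
    and "finite_distance U V"
  shows "t_bounded C V = t_bounded C U"
proof -
  obtain a b where l: "\<And>n. t_le C U (n + a) \<subseteq> t_le C V n" "\<And>n. t_le C V n \<subseteq> t_le C U (n + b)"
    "\<And>n. t_ge C V n \<subseteq> t_ge C U (n + a)" "\<And>n. t_ge C U (n + b) \<subseteq> t_ge C V n"
    using finite_distance_levels[OF assms] by metis
  have "X \<in> t_bounded C V \<longleftrightarrow> X \<in> t_bounded C U" for X
  proof
    assume "X \<in> t_bounded C V"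
    then show "X \<in> t_bounded C U"
      using t_on_bounded_iff[OF N V, of X] t_on_bounded_iff[OF N U, of X] l(2,3) by blast
  next
    assume "X \<in> t_bounded C U"
    then obtain m n where "X \<in> t_ge C U m" "X \<in> t_le C U n" using t_on_bounded_iff[OF N U, of X] by blast
    then have "X \<in> t_ge C V (m - b)" "X \<in> t_le C V (n - a)"
      using l(1)[of "n - a"] l(4)[of "m - b"] by auto
    then show "X \<in> t_bounded C V" using t_on_bounded_iff[OF N V, of X] by blast
  qed
  then show ?thesis by blast
qed

lemma finite_distance_restrict:
  assumes N: "triangulated_subset N" and U: "t_structure_on N U" and V: "t_structure_on N V"
    and c: "finite_distance U V"
  shows "finite_distance (t_restrict C U) (t_restrict C V)"
proof -
  obtain a b where "t_le C U a \<subseteq> fst V" "fst V \<subseteq> t_le C U b" using c unfolding finite_distance_def by blast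
  then have "t_le C (t_restrict C U) a \<subseteq> fst (t_restrict C V)"
    "fst (t_restrict C V) \<subseteq> t_le C (t_restrict C U) b"
    using t_restrict_le[OF N U] finite_distance_bounded_eq[OF assms] by (auto simp: t_restrict_def)
  then show ?thesis unfolding finite_distance_def by blast
qed

text \<open>
  Choose \<open>c\<close> with \<open>U\<^sub>\<le>\<^sub>c\<close> contained in both \<open>V\<^sub>\<le>\<^sub>0\<close> and \<open>W\<^sub>\<le>\<^sub>0\<close>. For \<open>X \<in> V\<^sub>\<le>\<^sub>0\<close>, the truncation of
  \<open>X\<close> at \<open>c\<close> by \<open>U\<close> has a third term in \<open>V\<^sub>\<le>\<^sub>0\<close> that is bounded, hence in \<open>W\<^sub>\<le>\<^sub>0\<close>.
\<close>

lemma finite_distance_restrict_subset: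
  assumes N: "triangulated_subset N" and U: "t_structure_on N U" and V: "t_structure_on N V"
    and W: "t_structure_on N W" and cV: "finite_distance U V" and cW: "finite_distance U W"
    and s: "fst (t_restrict C V) \<subseteq> fst (t_restrict C W)"
  shows "fst V \<subseteq> fst W"
proof
  fix X assume X: "X \<in> fst V"
  obtain a b where a: "t_le C U a \<subseteq> fst V" "fst V \<subseteq> t_le C U b" using cV unfolding finite_distance_def by blast
  obtain a' where a': "t_le C U a' \<subseteq> fst W" using cW unfolding finite_distance_def by blast
  let ?c = "min a a'"
  have cc: "t_le C U ?c \<subseteq> fst V" "t_le C U ?c \<subseteq> fst W"
    using a(1) a' t_on_le_mono[OF N U, of ?c a, OF min.cobounded1]
      t_on_le_mono[OF N U, of ?c a', OF min.cobounded2] by blast+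
  note P = t_on_torsion_pair[OF N V, of 0, unfolded t_on_le_zero[OF N V]]
  note Q = t_on_torsion_pair[OF N W, of 0, unfolded t_on_le_zero[OF N W]]
  have XN: "X \<in> N" using X t_on_subset(1)[OF N V] by blast
  obtain A B f g h where AB: "A \<in> t_le C U ?c" "B \<in> t_ge C U (?c + 1)" "exact_tri A X B f g h"
    using torsion_pair_exact_tri[OF t_on_torsion_pair[OF N U] XN] .
  then have e: "extension A X B" unfolding extension_def by blast
  note o = extension_objs[OF e]
  have "sig_obj C A \<in> fst V" using torsion_pairD(5)[OF P] cc(1) AB(1) by blast
  moreover have "extension X B (sig_obj C A)" using e extension_rotate_iff[OF o(1,2)] by simp
  ultimately have "B \<in> fst V" using torsion_pair_extension_left[OF N P] X by blast
  moreover have "B \<in> t_bounded C V"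
    using calculation a(2) AB(2) t_on_bounded_iff[OF N U, of B] finite_distance_bounded_eq[OF N U V cV] by blast
  ultimately have "B \<in> fst W" using s by (auto simp: t_restrict_def)
  then show "X \<in> fst W" using torsion_pair_extension_left[OF N Q e] AB(1) cc(2) by blast
qed

lemma t_restrict_inj:
  assumes N: "triangulated_subset N" and U: "t_structure_on N U" and V: "t_structure_on N V"
    and W: "t_structure_on N W" and cV: "finite_distance U V" and cW: "finite_distance U W"
    and e: "t_restrict C V = t_restrict C W"
  shows "V = W"
proof (rule t_on_eqI[OF N V W])
  show "fst V = fst W"
    using finite_distance_restrict_subset[OF N U V W cV cW] finite_distance_restrict_subset[OF N U W V cW cV] e by simp
qed

section \<open>Extending a t-structure from the bounded objects\<close>

text \<open>
  The aisle is \<open>U\<^sub>\<le>\<^sub>a * A'\<close> and its right orthogonal is \<open>B' * U\<^sub>>\<^sub>b\<close>, where \<open>S * R\<close> denotes the extensions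
  of objects of \<open>R\<close> by objects of \<open>S\<close>. An arbitrary object lies in
  \<open>U\<^sub>\<le>\<^sub>a * ((A' * B') * U\<^sub>>\<^sub>b) = (U\<^sub>\<le>\<^sub>a * A') * (B' * U\<^sub>>\<^sub>b)\<close>.
\<close>

lemma t_restrict_surj:
  assumes N: "triangulated_subset N" and U: "t_structure_on N U"
    and V': "t_structure_on (t_bounded C U) V'" and c: "finite_distance (t_restrict C U) V'"
  obtains V where "t_structure_on N V" "finite_distance U V" "t_restrict C V = V'"
proof -
  let ?B = "t_bounded C U"
  have B: "triangulated_subset ?B" using t_on_bounded_triangulated[OF N U] .
  note Ur = t_restrict_t_structure_on[OF N U]
  obtain a b where ab: "a \<le> b"
    and la: "\<And>n. t_le C (t_restrict C U) (n + a) \<subseteq> t_le C V' n"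
    and lb: "\<And>n. t_le C V' n \<subseteq> t_le C (t_restrict C U) (n + b)"
    and ga: "\<And>n. t_ge C V' n \<subseteq> t_ge C (t_restrict C U) (n + a)"
    using finite_distance_levels[OF B Ur V' c] by metis
  note P' = t_on_torsion_pair[OF B V', of 0, simplified]
  let ?A' = "t_le C V' 0" and ?B' = "t_ge C V' 1"
  have la0: "?B \<inter> t_le C U a \<subseteq> ?A'" using la[of 0] t_restrict_le[OF N U] by simp
  have lb0: "?A' \<subseteq> t_le C U b" using lb[of 0] t_restrict_le[OF N U] by simp
  have ga1: "?B' \<subseteq> t_ge C U (a + 1)" using ga[of 1] t_restrict_ge[OF N U] by (simp add: add.commute)
  note Pa = t_on_torsion_pair[OF N U, of a] and Pb = t_on_torsion_pair[OF N U, of b]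
  define A where "A = {X. \<exists>P \<in> t_le C U a. \<exists>Y \<in> ?A'. extension P X Y}"
  define D where "D = {X. \<exists>Y \<in> ?B'. \<exists>Q \<in> t_ge C U (b + 1). extension Y X Q}"
  have cA: "iso_closed C A"
  proof -
    have "X' \<in> A" if XA: "X \<in> A" and i: "isomorphic C X X'" for X X'
    proof -
      obtain P Y where PY: "P \<in> t_le C U a" "Y \<in> ?A'" and e: "extension P X Y"
        using XA unfolding A_def by blast
      have "extension P X' Y"
        using extension_iso[OF e _ i] isomorphic_refl extension_objs[OF e] by blast
      then show ?thesis using PY unfolding A_def by blast
    qed
    moreover have "A \<subseteq> obj C" unfolding A_def using extension_objs(2) by blast
    ultimately show ?thesis unfolding iso_closed_def by blast
  qed
  have cD: "iso_closed C D"
  proof -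
    have "X' \<in> D" if XA: "X \<in> D" and i: "isomorphic C X X'" for X X'
    proof -
      obtain P Y where PY: "P \<in> ?B'" "Y \<in> t_ge C U (b + 1)" and e: "extension P X Y"
        using XA unfolding D_def by blast
      have "extension P X' Y"
        using extension_iso[OF e _ i] isomorphic_refl extension_objs[OF e] by blast
      then show ?thesis using PY unfolding D_def by blast
    qed
    moreover have "D \<subseteq> obj C" unfolding D_def using extension_objs(2) by blast
    ultimately show ?thesis unfolding iso_closed_def by blast
  qed
  have Ab: "A \<subseteq> t_le C U b"
  proof
    fix X assume "X \<in> A"
    then obtain P Y where PY: "P \<in> t_le C U a" "Y \<in> ?A'" and e: "extension P X Y"
      unfolding A_def by blast
    have "P \<in> t_le C U b" using PY(1) t_on_le_mono[OF N U ab] by blast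
    then show "X \<in> t_le C U b" using t_on_le_extension[OF N U e] PY(2) lb0 by blast
  qed
  have Da: "D \<subseteq> t_ge C U (a + 1)"
  proof
    fix X assume "X \<in> D"
    then obtain P Y where PY: "P \<in> ?B'" "Y \<in> t_ge C U (b + 1)" and e: "extension P X Y"
      unfolding D_def by blast
    have "Y \<in> t_ge C U (a + 1)" using PY(2) t_on_ge_mono[OF N U, of "a + 1" "b + 1"] ab by auto
    then show "X \<in> t_ge C U (a + 1)" using t_on_ge_extension[OF N U e] PY(1) ga1 by blast
  qed
  have P: "torsion_pair N A D"
    unfolding torsion_pair_def
  proof (intro conjI ballI)
    show "iso_closed C A" "iso_closed C D" using cA cD .
    show "A \<subseteq> N" using Ab t_on_le_subset[OF N U] by blast
    show "D \<subseteq> N" using Da t_on_ge_subset[OF N U] by blast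
    show "sig_obj C X \<in> A" if XA: "X \<in> A" for X
    proof -
      obtain P Y where PY: "P \<in> t_le C U a" "Y \<in> ?A'" and e: "extension P X Y"
        using XA unfolding A_def by blast
      have "extension (sig_obj C P) (sig_obj C X) (sig_obj C Y)"
        using extension_sig_iff[OF extension_objs[OF e]] e by simp
      then show ?thesis
        using torsion_pairD(5)[OF Pa PY(1)] torsion_pairD(5)[OF P' PY(2)] unfolding A_def by blast
    qed
    show "hom_zero X Z" if XA: "X \<in> A" and ZD: "Z \<in> D" for X Z
    proof -
      obtain P Y where PY: "P \<in> t_le C U a" "Y \<in> ?A'" and e: "extension P X Y"
        using XA unfolding A_def by blast
      obtain R Q where RQ: "R \<in> ?B'" "Q \<in> t_ge C U (b + 1)" and e': "extension R Z Q"
        using ZD unfolding D_def by blast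
      have 1: "hom_zero P Z" using torsion_pairD(6)[OF Pa PY(1)] Da ZD by blast
      have 2: "hom_zero Y R" using torsion_pairD(6)[OF P' PY(2) RQ(1)] .
      have "hom_zero Y Q" using torsion_pairD(6)[OF Pb _ RQ(2)] PY(2) lb0 by blast
      then have "hom_zero Y Z" using hom_zero_extension_right[OF e' 2] by blast
      with 1 show ?thesis using hom_zero_extension_left[OF e] by blast
    qed
    fix Z assume Z: "Z \<in> N"
    obtain P M where PM: "P \<in> t_le C U a" "M \<in> t_ge C U (a + 1)" and e1: "extension P Z M"
      using torsion_pair_exact_tri[OF Pa Z] unfolding extension_def by metis
    have "M \<in> N" using PM(2) t_on_ge_subset[OF N U] by blast
    then obtain K Q where KQ: "K \<in> t_le C U b" "Q \<in> t_ge C U (b + 1)" and e2: "extension K M Q"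
      using torsion_pair_exact_tri[OF Pb] unfolding extension_def by metis
    note o = extension_objs[OF e2]
    \<comment> \<open>The middle piece is bounded: \<open>\<Sigma> K\<close> is an extension of \<open>\<Sigma> M\<close> by \<open>Q\<close>.\<close>
    have "K \<in> t_ge C U (a + 1)"
    proof -
      have "extension Q (sig_obj C K) (sig_obj C M)"
        using e2 extension_rotate_iff[OF o(1,2)] extension_rotate_iff[OF o(2,3)] by simp
      moreover have "sig_obj C M \<in> t_ge C U a" using t_on_ge_sig[OF N U o(2)] PM(2) by simp
      moreover have "Q \<in> t_ge C U a" using t_on_ge_mono[OF N U, of a "b + 1"] ab KQ(2) by auto
      ultimately have "sig_obj C K \<in> t_ge C U a" using t_on_ge_extension[OF N U] by blast
      then show ?thesis using t_on_ge_sig[OF N U o(1)] by simp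
    qed
    then have "K \<in> ?B" using KQ(1) t_on_bounded_iff[OF N U, of K] by blast
    then obtain Y R where YR: "Y \<in> ?A'" "R \<in> ?B'" and e3: "extension Y K R"
      using torsion_pair_exact_tri[OF P'] unfolding extension_def by metis
    \<comment> \<open>Regroup the four pieces \<open>P\<close>, \<open>Y\<close>, \<open>R\<close>, \<open>Q\<close> of \<open>Z\<close> as \<open>P\<close>, \<open>Y\<close> and \<open>R\<close>, \<open>Q\<close>.\<close>
    obtain W where W: "extension Y M W" "extension R W Q" using extension_assoc_left[OF e3 e2] .
    obtain F where F: "extension F Z W" "extension P F Y" using extension_assoc_right[OF e1 W(1)] .
    have "F \<in> A" "W \<in> D" using F(2) W(2) PM(1) KQ(2) YR unfolding A_def D_def by blast+
    then show "\<exists>X\<in>A. \<exists>Y\<in>D. extension X Z Y" using F(1) by blast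
  qed
  let ?V = "(A, shift C 1 D)"
  have V: "t_structure_on N ?V"
    unfolding t_structure_on_def
    using P cA iso_closed_shift[OF cD, of 1] shift_minus_one_one[OF cD] by simp
  obtain E where E: "zero_object C E" using ex_zero_object by blast
  have aA: "t_le C U a \<subseteq> A"
  proof
    fix X assume X: "X \<in> t_le C U a"
    then have "X \<in> obj C" using torsion_pairD(7)[OF Pa] by blast
    then have "extension X X E" using extension_zero_right E by blast
    then show "X \<in> A" using X torsion_pair_zero(1)[OF B P' E] unfolding A_def by blast
  qed
  have cl: "finite_distance U ?V" unfolding finite_distance_def using aA Ab by auto
  have "fst (t_restrict C ?V) = fst V'"
  proof -
    have "X \<in> ?A'" if XB: "X \<in> ?B" and XA: "X \<in> A" for X
    proof -
      obtain P Y where PY: "P \<in> t_le C U a" "Y \<in> ?A'" and e: "extension P X Y"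
        using XA unfolding A_def by blast
      have "Y \<in> ?B" using PY(2) torsion_pairD(3)[OF P'] by blast
      then have "P \<in> ?B" using triangulated_subset_fibre[OF B e XB] by blast
      then have "P \<in> ?A'" using PY(1) la0 by blast
      then show ?thesis using torsion_pair_extension_left[OF B P' e] PY(2) by blast
    qed
    moreover have "X \<in> A" if X: "X \<in> ?A'" for X
    proof -
      have "X \<in> obj C" using X torsion_pairD(7)[OF P'] by blast
      then have "extension E X X" using extension_zero_left E by blast
      then show ?thesis using X torsion_pair_zero(1)[OF N Pa E] unfolding A_def by blast
    qed
    ultimately have "?B \<inter> A = ?A'" using torsion_pairD(3)[OF P'] by blast
    then show ?thesis
      using finite_distance_bounded_eq[OF N U V cl] t_on_le_zero[OF B V'] by (simp add: t_restrict_def)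
  qed
  then have "t_restrict C ?V = V'"
    using t_on_eqI[OF B _ V'] t_restrict_t_structure_on[OF N V] finite_distance_bounded_eq[OF N U V cl] by simp
  then show ?thesis using that V cl by blast
qed

section \<open>Hereditary t-structures\<close>

lemma tau_le_coreflection:
  assumes U: "t_structure_on (obj C) U" and X: "X \<in> obj C"
  shows "coreflection C (t_le C U n) X (tau_le C U n X)"
proof -
  note P = t_on_torsion_pair[OF triangulated_subset_obj U, of n]
  obtain A B f g h where "A \<in> t_le C U n" "B \<in> t_ge C U (n + 1)" "exact_tri A X B f g h"
    using torsion_pair_exact_tri[OF P X] .
  from torsion_pair_coreflection[OF P this(3,1,2)] show ?thesis unfolding tau_le_def by (rule someI)
qed

lemma tau_ge_reflection:
  assumes U: "t_structure_on (obj C) U" and X: "X \<in> obj C"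
  shows "reflection C (t_ge C U n) X (tau_ge C U n X)"
proof -
  note P = t_on_torsion_pair'[OF triangulated_subset_obj U, of n]
  obtain A B f g h where "A \<in> t_le C U (n - 1)" "B \<in> t_ge C U n" "exact_tri A X B f g h"
    using torsion_pair_exact_tri[OF P X] .
  from torsion_pair_reflection[OF P this(3,1,2)] show ?thesis unfolding tau_ge_def by (rule someI)
qed

text \<open>
  Regularity refers to chosen counits in all degrees. Each of them factors through the first arrow
  of any truncation triangle in a higher degree, so it is enough to control truncation triangles in
  large degrees.
\<close>

lemma regular_hom_zero_left:
  assumes U: "t_structure_on (obj C) U" and reg: "regular C U"
    and X: "X \<in> obj C" and Y: "Y \<in> t_le C U m"
    and trunc: "\<And>k P Q. \<lbrakk>l \<le> k; P \<in> t_le C U k; Q \<in> t_ge C U (k + 1); extension P X Q\<rbrakk>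
      \<Longrightarrow> hom_zero P Y"
  shows "hom_zero X Y"
  unfolding hom_zero_def
proof
  fix u assume u: "u \<in> homs C X Y"
  note N = triangulated_subset_obj
  have Yo: "Y \<in> obj C" using homs_obj[OF u] by blast
  have z: "zero_arr C X Y \<in> homs C X Y" using zero_homs[OF X Yo] .
  have "u \<cdot> tau_le C U n X = zero_arr C X Y \<cdot> tau_le C U n X" for n
  proof -
    let ?e = "tau_le C U n X" and ?k = "max n l"
    have e: "?e \<in> homs C (src C ?e) X" "src C ?e \<in> t_le C U n"
      using tau_le_coreflection[OF U X] unfolding coreflection_def by blast+
    have ek: "src C ?e \<in> t_le C U ?k" using t_on_le_mono[OF N U max.cobounded1] e(2) by blast
    note P = t_on_torsion_pair[OF N U, of ?k]
    obtain A B f g h where AB: "A \<in> t_le C U ?k" "B \<in> t_ge C U (?k + 1)"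
      and t: "exact_tri A X B f g h"
      using torsion_pair_exact_tri[OF P X] .
    note f = exact_triD(2)[OF t]
    have "extension A X B" using t unfolding extension_def by blast
    then have hz: "hom_zero A Y" using trunc[OF max.cobounded2 AB] by simp
    have "g \<cdot> ?e = zero_arr C (src C ?e) B"
      using hom_zeroD[OF torsion_pairD(6)[OF P ek AB(2)] cmp_homs[OF e(1) exact_triD(3)[OF t]]] .
    then obtain w where w: "w \<in> homs C (src C ?e) A" "?e = f \<cdot> w"
      using exact_tri_covariant[OF t e(1)] by metis
    have "u \<cdot> ?e = (u \<cdot> f) \<cdot> w" using cmp_assoc[OF w(1) f u] w(2) by simp
    also have "\<dots> = zero_arr C (src C ?e) Y"
      using hom_zeroD[OF hz cmp_homs[OF f u]] cmp_zero_left[OF w(1) Yo] by simp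
    also have "\<dots> = zero_arr C X Y \<cdot> ?e" using cmp_zero_left[OF e(1) Yo] by simp
    finally show ?thesis .
  qed
  moreover have "inj_on (\<lambda>f n. f \<cdot> tau_le C U n X) (homs C X Y)"
    using reg X Y unfolding regular_def injective_map_def by blast
  ultimately have "u = zero_arr C X Y" using u z unfolding inj_on_def by blast
  then show "u \<in> {zero_arr C X Y}" by simp
qed

text \<open>
  Dually, every chosen unit factors through the second arrow of a truncation triangle in a lower
  degree.
\<close>

lemma regular_hom_zero_right:
  assumes U: "t_structure_on (obj C) U" and reg: "regular C U"
    and X: "X \<in> t_ge C U m" and Y: "Y \<in> obj C"
    and trunc: "\<And>k P Q. \<lbrakk>k \<le> l; P \<in> t_le C U (k - 1); Q \<in> t_ge C U k; extension P Y Q\<rbrakk>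
      \<Longrightarrow> hom_zero X Q"
  shows "hom_zero X Y"
  unfolding hom_zero_def
proof
  fix u assume u: "u \<in> homs C X Y"
  note N = triangulated_subset_obj
  have Xo: "X \<in> obj C" using homs_obj[OF u] by blast
  have z: "zero_arr C X Y \<in> homs C X Y" using zero_homs[OF Xo Y] .
  have "tau_ge C U (- n) Y \<cdot> u = tau_ge C U (- n) Y \<cdot> zero_arr C X Y" for n
  proof -
    let ?e = "tau_ge C U (- n) Y" and ?k = "min (- n) l"
    have e: "?e \<in> homs C Y (tgt C ?e)" "tgt C ?e \<in> t_ge C U (- n)"
      using tau_ge_reflection[OF U Y] unfolding reflection_def by blast+
    have ek: "tgt C ?e \<in> t_ge C U ?k" using t_on_ge_mono[OF N U min.cobounded1] e(2) by blast
    note P = t_on_torsion_pair'[OF N U, of ?k]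
    obtain A B f g h where AB: "A \<in> t_le C U (?k - 1)" "B \<in> t_ge C U ?k"
      and t: "exact_tri A Y B f g h"
      using torsion_pair_exact_tri[OF P Y] .
    note g = exact_triD(3)[OF t]
    have eo: "tgt C ?e \<in> obj C" using homs_obj[OF e(1)] by blast
    have "extension A Y B" using t unfolding extension_def by blast
    then have hz: "hom_zero X B" using trunc[OF min.cobounded2 AB] by simp
    have "?e \<cdot> f = zero_arr C A (tgt C ?e)"
      using hom_zeroD[OF torsion_pairD(6)[OF P AB(1) ek] cmp_homs[OF exact_triD(2)[OF t] e(1)]] .
    then obtain w where w: "w \<in> homs C B (tgt C ?e)" "?e = w \<cdot> g"
      using exact_tri_contravariant[OF t e(1)] by metis
    have "?e \<cdot> u = w \<cdot> (g \<cdot> u)" using cmp_assoc[OF u g w(1)] w(2) by simp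
    also have "\<dots> = zero_arr C X (tgt C ?e)"
      using hom_zeroD[OF hz cmp_homs[OF u g]] cmp_zero_right[OF w(1) Xo] by simp
    also have "\<dots> = ?e \<cdot> zero_arr C X Y" using cmp_zero_right[OF e(1) Xo] by simp
    finally show ?thesis .
  qed
  moreover have "inj_on (\<lambda>f n. tau_ge C U (- n) Y \<cdot> f) (homs C X Y)"
    using reg X Y unfolding regular_def injective_map_def by blast
  ultimately have "u = zero_arr C X Y" using u z unfolding inj_on_def by blast
  then show "u \<in> {zero_arr C X Y}" by simp
qed

text \<open>
  Heredity with the vanishing of arrows tested in the ambient category, so that it makes sense for a
  t-structure on a subcategory.
\<close>

definition hom_zero_hereditary :: "'a tpair \<Rightarrow> bool" where
  "hom_zero_hereditary V \<longleftrightarrow> (\<forall>X \<in> t_ge C V 0. \<forall>Y \<in> t_le C V (- 2). hom_zero X Y)"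

text \<open>
  For bounded \<open>X\<close>, truncate \<open>Y\<close> from below so far out that the removed part \<open>P\<close> satisfies
  \<open>\<Sigma> P \<in> V\<^sub>\<le>\<^sub>-\<^sub>2\<close>; then the truncation stays in \<open>V\<^sub>\<le>\<^sub>-\<^sub>2\<close>. The general case follows by truncating \<open>X\<close>
  from above so far out that the removed part lies in \<open>V\<^sub>\<ge>\<^sub>-\<^sub>1\<close>, which keeps the truncation in \<open>V\<^sub>\<ge>\<^sub>0\<close>.
\<close>

lemma hom_zero_hereditary_restrict_iff:
  assumes U: "t_structure_on (obj C) U" and V: "t_structure_on (obj C) V" and c: "finite_distance U V"
    and reg: "regular C U"
  shows "hom_zero_hereditary (t_restrict C V) \<longleftrightarrow> hom_zero_hereditary V"
proof
  note N = triangulated_subset_obj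
  show "hom_zero_hereditary (t_restrict C V)" if "hom_zero_hereditary V"
    using that t_restrict_le[OF N V] t_restrict_ge[OF N V] unfolding hom_zero_hereditary_def by blast
  assume h: "hom_zero_hereditary (t_restrict C V)"
  then have h: "hom_zero X Y" if "X \<in> t_ge C V 0" "Y \<in> t_le C V (- 2)"
    "X \<in> t_bounded C U" "Y \<in> t_bounded C U" for X Y
    using that t_restrict_le[OF N V] t_restrict_ge[OF N V] finite_distance_bounded_eq[OF N U V c]
    unfolding hom_zero_hereditary_def by blast
  obtain a b where la: "\<And>n. t_le C U (n + a) \<subseteq> t_le C V n" and lb: "\<And>n. t_le C V n \<subseteq> t_le C U (n + b)"
    and ga: "\<And>n. t_ge C V n \<subseteq> t_ge C U (n + a)" and gb: "\<And>n. t_ge C U (n + b) \<subseteq> t_ge C V n"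
    using finite_distance_levels[OF N U V c] by metis
  have bounded_left: "hom_zero X Y"
    if X: "X \<in> t_ge C V 0" "X \<in> t_bounded C U" and Y: "Y \<in> t_le C V (- 2)" for X Y
  proof (rule regular_hom_zero_right[OF U reg, where m = "0 + a" and l = a])
    show "X \<in> t_ge C U (0 + a)" using X(1) ga by blast
    show "Y \<in> obj C" using Y t_on_le_subset[OF N V] by blast
    fix k P Q assume k: "k \<le> a" and P: "P \<in> t_le C U (k - 1)" and Q: "Q \<in> t_ge C U k"
      and e: "extension P Y Q"
    note o = extension_objs[OF e]
    have "sig_obj C P \<in> t_le C U (k - 2)" using t_on_le_sig[OF N U o(1), of "k - 2"] P by simp
    moreover have "t_le C U (k - 2) \<subseteq> t_le C U (- 2 + a)" using t_on_le_mono[OF N U] k by simp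
    ultimately have "sig_obj C P \<in> t_le C V (- 2)" using la[of "- 2"] by blast
    moreover have "extension Y Q (sig_obj C P)" using e extension_rotate_iff[OF o(1,2)] by simp
    ultimately have QV: "Q \<in> t_le C V (- 2)" using t_on_le_extension[OF N V] Y by blast
    then have "Q \<in> t_bounded C U" using Q lb t_on_bounded_iff[OF N U, of Q] by blast
    then show "hom_zero X Q" using h X QV by blast
  qed
  show "hom_zero_hereditary V" unfolding hom_zero_hereditary_def
  proof (intro ballI)
    fix X Y assume X: "X \<in> t_ge C V 0" and Y: "Y \<in> t_le C V (- 2)"
    show "hom_zero X Y"
    proof (rule regular_hom_zero_left[OF U reg, where m = "- 2 + b" and l = b])
      show "X \<in> obj C" using X t_on_ge_subset[OF N V] by blast
      show "Y \<in> t_le C U (- 2 + b)" using Y lb by blast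
      fix k P Q assume k: "b \<le> k" and P: "P \<in> t_le C U k" and Q: "Q \<in> t_ge C U (k + 1)"
        and e: "extension P X Q"
      note o = extension_objs[OF e]
      have "t_ge C U (k + 1) \<subseteq> t_ge C U (- 1 + b)" using t_on_ge_mono[OF N U] k by simp
      then have "Q \<in> t_ge C V (- 1)" using Q gb[of "- 1"] by blast
      moreover have "sig_obj C X \<in> t_ge C V (- 1)" using t_on_ge_sig[OF N V o(2), of "- 1"] X by simp
      moreover have "extension Q (sig_obj C P) (sig_obj C X)"
        using e extension_rotate_iff[OF o(1,2)] extension_rotate_iff[OF o(2,3)] by simp
      ultimately have "sig_obj C P \<in> t_ge C V (- 1)" using t_on_ge_extension[OF N V] by blast
      then have PV: "P \<in> t_ge C V 0" using t_on_ge_sig[OF N V o(1), of "- 1"] by simp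
      then have "P \<in> t_bounded C U" using P ga t_on_bounded_iff[OF N U, of P] by blast
      then show "hom_zero P Y" using bounded_left PV Y by blast
    qed
  qed
qed

end

section \<open>The full subcategory on a triangulated subset\<close>

context
  fixes C :: "('o, 'a) tricat" and N :: "'o set"
  assumes tricat: "triangulated_category C"
    and N: "triangulated_category.triangulated_subset C N"
begin

interpretation triangulated_category C by (rule tricat)

abbreviation (input) "D \<equiv> full_subcat C N"

lemma full_subcat_simps:
  "obj D = obj C \<inter> N" "arr D = {f \<in> arr C. src C f \<in> N \<and> tgt C f \<in> N}"
  "src D = src C" "tgt D = tgt C" "idt D = idt C" "cmp D = cmp C" "zero_arr D = zero_arr C"
  "sig_obj D = sig_obj C"
  "tri D = tri C \<inter> arr D \<times> arr D \<times> arr D"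
  by (simp_all add: full_subcat_def Let_def)

lemma full_subcat_obj: "obj D = N"
  using triangulated_subsetD(2)[OF N] by (auto simp: full_subcat_simps)

lemma homs_full_subcat: "\<lbrakk>X \<in> N; Y \<in> N\<rbrakk> \<Longrightarrow> homs D X Y = homs C X Y"
  by (auto simp: homs_def full_subcat_simps)

lemma isomorphic_full_subcat: "\<lbrakk>X \<in> N; Y \<in> N\<rbrakk> \<Longrightarrow> isomorphic D X Y \<longleftrightarrow> isomorphic C X Y"
  by (simp add: isomorphic_iff homs_full_subcat full_subcat_simps)

lemma iso_closed_full_subcat: "iso_closed D S \<longleftrightarrow> iso_closed C S \<and> S \<subseteq> N"
proof
  assume *: "iso_closed D S"
  then have SN: "S \<subseteq> N" unfolding iso_closed_def full_subcat_obj by blast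
  have "Y \<in> S" if "X \<in> S" "Y \<in> obj C" "isomorphic C X Y" for X Y
  proof -
    have "X \<in> N" using that SN by blast
    then have "Y \<in> N" using iso_closedD[OF triangulated_subsetD(1)[OF N]] that by blast
    then show ?thesis
      using * isomorphic_full_subcat[OF \<open>X \<in> N\<close>] that unfolding iso_closed_def full_subcat_obj by blast
  qed
  then show "iso_closed C S \<and> S \<subseteq> N"
    using SN triangulated_subsetD(2)[OF N] unfolding iso_closed_def by blast
next
  assume *: "iso_closed C S \<and> S \<subseteq> N"
  then have "Y \<in> S" if "X \<in> S" "Y \<in> N" "isomorphic D X Y" for X Y
    using isomorphic_full_subcat[of X Y] iso_closedD[of S X Y] that by blast
  then show "iso_closed D S" using * unfolding iso_closed_def full_subcat_obj by blast
qed

lemma shift_full_subcat: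
  assumes "S \<subseteq> N"
  shows "shift D n S = shift C n S"
proof -
  note No = triangulated_subsetD(2)[OF N]
  have sub: "shift C n S \<subseteq> N" using shift_mono[OF assms] shift_triangulated_subset[OF N] by blast
  have pow: "(sig_obj C ^^ k) Y \<in> N" if "Y \<in> N" for k Y
  proof (induction k)
    case (Suc k)
    then show ?case using triangulated_subsetD(3)[OF N] No by auto
  qed (simp add: that)
  have "X \<in> shift D n S \<longleftrightarrow> X \<in> shift C n S" if X: "X \<in> N" for X
  proof -
    have "isomorphic D ((sig_obj C ^^ k) Y) X \<longleftrightarrow> isomorphic C ((sig_obj C ^^ k) Y) X" if "Y \<in> S" for Y k
      using isomorphic_full_subcat[OF pow X] that assms by blast
    then show ?thesis using X No by (auto simp: shift_def full_subcat_obj full_subcat_simps(8))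
  qed
  moreover have "shift D n S \<subseteq> N" unfolding shift_def full_subcat_obj by auto
  ultimately show ?thesis using sub by blast
qed

text \<open>
  The orthogonal condition and the truncation triangles of a torsion pair on \<open>N\<close> only involve objects
  of \<open>N\<close>. Stability of the upper half under \<open>\<Sigma>\<^sup>-\<^sup>1\<close> follows from stability of the aisle under \<open>\<Sigma>\<close>,
  since this half consists of right orthogonals.
\<close>

lemma t_structure_full_subcat_iff: "t_structure D V \<longleftrightarrow> t_structure_on N V"
proof
  note No = triangulated_subsetD(2)[OF N]
  assume V: "t_structure D V"
  have c: "iso_closed C (fst V)" "iso_closed C (snd V)" and s: "fst V \<subseteq> N" "snd V \<subseteq> N"
    using V unfolding t_structure_def iso_closed_full_subcat by auto
  note sh = shift_full_subcat[OF s(1)] shift_full_subcat[OF s(2)]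
  have sN: "shift C (- 1) (snd V) \<subseteq> N"
    using shift_mono[OF s(2)] shift_triangulated_subset[OF N] by blast
  have 1: "shift C 1 (fst V) \<subseteq> fst V"
    and 2: "\<And>X Y. X \<in> fst V \<Longrightarrow> Y \<in> shift C (- 1) (snd V) \<Longrightarrow> homs D X Y = {zero_arr C X Y}"
    and 3: "\<And>Z. Z \<in> N \<Longrightarrow> \<exists>f g h. (f, g, h) \<in> tri D \<and>
        src C f \<in> fst V \<and> tgt C f = Z \<and> tgt C g \<in> shift C (- 1) (snd V)"
    using V unfolding t_structure_def sh full_subcat_obj full_subcat_simps(3,4,7) by blast+
  have "torsion_pair N (fst V) (shift C (- 1) (snd V))"
    unfolding torsion_pair_def
  proof (intro conjI ballI)
    show "iso_closed C (fst V)" "iso_closed C (shift C (- 1) (snd V))" "fst V \<subseteq> N"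
      "shift C (- 1) (snd V) \<subseteq> N"
      using c s sN iso_closed_shift by auto
    show "sig_obj C X \<in> fst V" if X: "X \<in> fst V" for X
    proof -
      have "sig_obj C X \<in> obj C" using X s No sig_obj_obj by blast
      then have "sig_obj C X \<in> shift C 1 (fst V)" using X isomorphic_refl unfolding shift_one by blast
      then show ?thesis using 1 by blast
    qed
    show "hom_zero X Y" if "X \<in> fst V" "Y \<in> shift C (- 1) (snd V)" for X Y
      using 2[OF that] homs_full_subcat[of X Y] that s sN unfolding hom_zero_def by auto
    fix Z assume "Z \<in> N"
    then obtain f g h where fgh: "(f, g, h) \<in> tri D"
      "src C f \<in> fst V" "tgt C f = Z" "tgt C g \<in> shift C (- 1) (snd V)"
      using 3 by blast
    then have "(f, g, h) \<in> tri C" by (simp add: full_subcat_simps(9))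
    then have "extension (src C f) Z (tgt C g)"
      using tri_exact_tri[of f g h] fgh(3) unfolding extension_def by auto
    then show "\<exists>X\<in>fst V. \<exists>Y\<in>shift C (- 1) (snd V). extension X Z Y" using fgh by blast
  qed
  then show "t_structure_on N V" using c unfolding t_structure_on_def by blast
next
  note No = triangulated_subsetD(2)[OF N]
  assume V: "t_structure_on N V"
  note c = t_on_iso_closed[OF N V] and s = t_on_subset[OF N V]
  note sh = shift_full_subcat[OF s(1)] shift_full_subcat[OF s(2)]
  have ge1: "t_ge C V 1 = shift C (- 1) (snd V)" by (simp add: t_ge_def)
  have P: "torsion_pair N (fst V) (shift C (- 1) (snd V))" using V unfolding t_structure_on_def by blast
  show "t_structure D V"
    unfolding t_structure_def sh full_subcat_obj full_subcat_simps(3,4,7)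
  proof (intro conjI ballI)
    show "iso_closed D (fst V)" "iso_closed D (snd V)" using c s iso_closed_full_subcat by auto
    show "shift C 1 (fst V) \<subseteq> fst V"
      using iso_closedD[OF c(1)] torsion_pairD(5)[OF P] unfolding shift_one by blast
    show "shift C (- 1) (snd V) \<subseteq> snd V"
      using t_on_ge_mono[OF N V, of 0 1] t_on_ge_zero[OF N V] ge1 by simp
    show "homs D X Y = {zero_arr C X Y}" if "X \<in> fst V" "Y \<in> shift C (- 1) (snd V)" for X Y
    proof -
      have XY: "X \<in> N" "Y \<in> N" using that torsion_pairD(3,4)[OF P] by auto
      then show ?thesis
        using homs_full_subcat[OF XY] hom_zero_iff[of X Y] No torsion_pairD(6)[OF P that] by blast
    qed
    fix Z assume Z: "Z \<in> N"
    obtain X Y f g h where XY: "X \<in> fst V" "Y \<in> shift C (- 1) (snd V)" "exact_tri X Z Y f g h"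
      using torsion_pair_exact_tri[OF P Z] .
    have XYN: "X \<in> N" "Y \<in> N" using XY torsion_pairD(3,4)[OF P] by auto
    then have sX: "sig_obj C X \<in> N" using triangulated_subsetD(3)[OF N] No by blast
    note t = XY(3)
    have "(f, g, h) \<in> tri D"
      using exact_triD(1)[OF t] homsD[OF exact_triD(2)[OF t]] homsD[OF exact_triD(3)[OF t]]
        homsD[OF exact_triD(4)[OF t]] XYN sX Z by (simp add: full_subcat_simps)
    moreover have "src C f = X" "tgt C f = Z" "tgt C g = Y"
      using homsD[OF exact_triD(2)[OF t]] homsD[OF exact_triD(3)[OF t]] by auto
    ultimately show "\<exists>f g h. (f, g, h) \<in> tri D \<and> src C f \<in> fst V \<and> tgt C f = Z \<and>
        tgt C g \<in> shift C (- 1) (snd V)" using XY(1,2) by blast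
  qed
qed

lemma t_le_full_subcat: "t_structure_on N V \<Longrightarrow> t_le D V n = t_le C V n"
  using shift_full_subcat[OF t_on_subset(1)[OF N]] by (simp add: t_le_def)

lemma t_ge_full_subcat: "t_structure_on N V \<Longrightarrow> t_ge D V n = t_ge C V n"
  using shift_full_subcat[OF t_on_subset(2)[OF N]] by (simp add: t_ge_def)

lemma finite_dist_full_subcat:
  assumes "t_structure_on N U"
  shows "finite_dist_t_structures D U = {V. t_structure_on N V \<and> finite_distance U V}"
proof -
  have "t_dist D U V < \<infinity> \<longleftrightarrow> finite_distance U V" if "t_structure_on N V" for V
    using t_dist_finite_iff[OF N assms that] t_le_full_subcat[OF that] by (simp add: t_dist_def)
  then show ?thesis
    unfolding finite_dist_t_structures_def t_structure_full_subcat_iff by blast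
qed

lemma hereditary_full_subcat_iff:
  assumes V: "t_structure_on N V"
  shows "hereditary D V \<longleftrightarrow> hom_zero_hereditary V"
proof -
  have "homs D X Y = {zero_arr D X Y} \<longleftrightarrow> hom_zero X Y"
    if "X \<in> t_ge C V 0" "Y \<in> t_le C V (- 2)" for X Y
  proof -
    have XY: "X \<in> N" "Y \<in> N" using that t_on_le_subset[OF N V] t_on_ge_subset[OF N V] by auto
    then show ?thesis
      using homs_full_subcat[OF XY] hom_zero_iff[of X Y] triangulated_subsetD(2)[OF N]
      by (auto simp: full_subcat_simps(7))
  qed
  then show ?thesis
    unfolding hereditary_def hom_zero_hereditary_def t_le_full_subcat[OF V] t_ge_full_subcat[OF V] by blast
qed

end

text \<open>
  Makes the comparison of t-structures on \<open>N\<close> with those of the full subcategory applicable to the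
  whole category.
\<close>

lemma full_subcat_all:
  fixes C :: "('o, 'a) tricat"
  assumes "triangulated_category C"
  shows "full_subcat C (obj C) = C"
proof -
  interpret triangulated_category C by fact
  have 1: "{f \<in> arr C. src C f \<in> obj C \<and> tgt C f \<in> obj C} = arr C" using src_obj tgt_obj by blast
  have "f \<in> arr C \<and> g \<in> arr C \<and> h \<in> arr C" if "(f, g, h) \<in> tri C" for f g h
    using tri_triangle[OF that] by (simp add: triangle_def homs_def)
  then have 2: "tri C \<inter> arr C \<times> arr C \<times> arr C = tri C" by auto
  show ?thesis by (simp add: full_subcat_def Let_def 1 2)
qed

lemma bij_betw_Collect:
  assumes "bij_betw f A B" "\<And>x. x \<in> A \<Longrightarrow> P x \<longleftrightarrow> Q (f x)"
  shows "bij_betw f {x \<in> A. P x} {y \<in> B. Q y}"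
  using assms by (auto simp: bij_betw_def inj_on_def)

theorem proposition5p4:
  fixes T :: "('o, 'a) tricat" and Tb :: "('o, 'a) tricat" and U Ub :: "'o set \<times> 'o set"
  assumes "triangulated_category T"
    and "t_structure T U"
    and "regular T U"
  defines "Tb \<equiv> full_subcat T (t_bounded T U)"
    and "Ub \<equiv> t_restrict T U"
  shows "bij_betw (t_restrict T) (finite_dist_t_structures T U) (finite_dist_t_structures Tb Ub) \<and>
         bij_betw (t_restrict T) (hereditary_finite_dist_t_structures T U)
           (hereditary_finite_dist_t_structures Tb Ub)"
proof -
  interpret triangulated_category T by fact
  let ?B = "t_bounded T U"
  note tc = assms(1)
  note N = triangulated_subset_obj and all = full_subcat_all[OF assms(1)]
  have U: "t_structure_on (obj T) U"
    using t_structure_full_subcat_iff[OF tc N] assms(2) unfolding all by simp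
  have B: "triangulated_subset ?B" using t_on_bounded_triangulated[OF N U] .
  have Ub: "t_structure_on ?B Ub" unfolding Ub_def using t_restrict_t_structure_on[OF N U] .
  have F: "finite_dist_t_structures T U = {V. t_structure_on (obj T) V \<and> finite_distance U V}"
    using finite_dist_full_subcat[OF tc N U] unfolding all .
  have Fb: "finite_dist_t_structures Tb Ub = {V. t_structure_on ?B V \<and> finite_distance Ub V}"
    using finite_dist_full_subcat[OF tc B Ub] unfolding Tb_def .
  have restr: "t_structure_on ?B (t_restrict T V)" "finite_distance Ub (t_restrict T V)"
    if "t_structure_on (obj T) V" "finite_distance U V" for V
    using t_restrict_t_structure_on[OF N that(1)] finite_distance_bounded_eq[OF N U that]
      finite_distance_restrict[OF N U that] by (simp_all add: Ub_def)
  have bij: "bij_betw (t_restrict T) (finite_dist_t_structures T U) (finite_dist_t_structures Tb Ub)"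
    unfolding bij_betw_def F Fb
  proof
    show "inj_on (t_restrict T) {V. t_structure_on (obj T) V \<and> finite_distance U V}"
      using t_restrict_inj[OF N U] by (auto intro!: inj_onI)
    show "t_restrict T ` {V. t_structure_on (obj T) V \<and> finite_distance U V} = {V. t_structure_on ?B V \<and> finite_distance Ub V}"
    proof
      show "t_restrict T ` {V. t_structure_on (obj T) V \<and> finite_distance U V}
          \<subseteq> {V. t_structure_on ?B V \<and> finite_distance Ub V}"
        using restr by blast
      show "{V. t_structure_on ?B V \<and> finite_distance Ub V}
          \<subseteq> t_restrict T ` {V. t_structure_on (obj T) V \<and> finite_distance U V}"
      proof
        fix V' assume "V' \<in> {V. t_structure_on ?B V \<and> finite_distance Ub V}"
        then obtain V where "t_structure_on (obj T) V" "finite_distance U V" "t_restrict T V = V'"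
          using t_restrict_surj[OF N U] unfolding Ub_def by blast
        then show "V' \<in> t_restrict T ` {V. t_structure_on (obj T) V \<and> finite_distance U V}" by blast
      qed
    qed
  qed
  have "hereditary T V \<longleftrightarrow> hereditary Tb (t_restrict T V)" if "V \<in> finite_dist_t_structures T U" for V
  proof -
    have V: "t_structure_on (obj T) V" "finite_distance U V" using that unfolding F by auto
    have "hereditary T V \<longleftrightarrow> hom_zero_hereditary V"
      using hereditary_full_subcat_iff[OF tc N V(1)] unfolding all .
    also have "\<dots> \<longleftrightarrow> hom_zero_hereditary (t_restrict T V)"
      using hom_zero_hereditary_restrict_iff[OF U V assms(3)] by simp
    also have "\<dots> \<longleftrightarrow> hereditary Tb (t_restrict T V)"
      using hereditary_full_subcat_iff[OF tc B restr(1)[OF V]] unfolding Tb_def by simp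
    finally show ?thesis .
  qed
  then show ?thesis
    using bij bij_betw_Collect[OF bij, of "hereditary T" "hereditary Tb"]
    unfolding hereditary_finite_dist_t_structures_def by simp
qed

end
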